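(* Any consistent system of proper congruences has a quasi-solution in the sphere $S^2$ using nonempty open sets, where arbitrary isometries of $S^2$ may be used as witnesses. That is, for any consistent system of proper congruences $(L_i,R_i)$, $1\le i\le m$, on the index set $\{1,\dots,r\}$, there exist nonempty open sets $A_1,\dots,A_r\subseteq S^2$, pairwise with meager intersection and with comeager union in $S^2$, and isometries $\sigma_1,\dots,\sigma_m$ of $S^2$, such that for each $i\le m$ the set $\sigma_i\bigl(\bigcup_{k\in L_i}A_k\bigr)$ differs from $\bigcup_{k\in R_i}A_k$ by a meager set.
   Context: $S^2$ is the two-dimensional sphere. Fix a positive integer $r$; for $S\subseteq\{1,\dots,r\}$ write $S^c=\{1,\dots,r\}\setminus S$. A congruence is a pair $(L,R)$ of subsets of $\{1,\dots,r\}$, written formally $\bigcup_{k\in L}A_k\cong\bigcup_{k\in R}A_k$; it is proper if both $L$ and $R$ are nonempty proper subsets of $\{1,\dots,r\}$. A system of congruences is a finite list of pairs $(L_i,R_i)$, $i\le m$. Let $\preceq$ be the smallest transitive relation on subsets of $\{1,\dots,r\}$ such that $L\preceq R$ whenever $L\subseteq R$, and $L_i\preceq R_i$, $R_i\preceq L_i$, $L_i^c\preceq R_i^c$, $R_i^c\preceq L_i^c$ for all $i\le m$ (deducible subcongruences). The system is consistent if there are no $L,R$ with $R$ a proper subset of $L$ and $L\preceq R$. "Differs by a meager set" means the symmetric difference is meager. *)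

theory Defs
  imports "HOL-Analysis.Analysis"
begin

definition nowhere_dense_in :: "'a topology \<Rightarrow> 'a set \<Rightarrow> bool" where
  "nowhere_dense_in X S \<longleftrightarrow> S \<subseteq> topspace X \<and> X interior_of (X closure_of S) = {}"

definition meager_in :: "'a topology \<Rightarrow> 'a set \<Rightarrow> bool" where
  "meager_in X = countable union_of nowhere_dense_in X"

definition comeager_in :: "'a topology \<Rightarrow> 'a set \<Rightarrow> bool" where
  "comeager_in X S \<longleftrightarrow> S \<subseteq> topspace X \<and> meager_in X (topspace X - S)"

abbreviation S2 :: "(real ^ 3) set" where
  "S2 \<equiv> sphere 0 1"

(* On the sphere, isometries for the chordal metric used here and for the
   geodesic metric coincide.  Orientation-reversing ones are included.
   Values of f outside M are irrelevant. *)
definition isometry_of :: "'a::metric_space set \<Rightarrow> ('a \<Rightarrow> 'a) \<Rightarrow> bool" where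
  "isometry_of M f \<longleftrightarrow> f ` M = M \<and> (\<forall>x\<in>M. \<forall>y\<in>M. dist (f x) (f y) = dist x y)"

type_synonym congruence = "nat set \<times> nat set"

definition proper_congruence :: "nat \<Rightarrow> congruence \<Rightarrow> bool" where
  "proper_congruence r c \<longleftrightarrow>
     (case c of (L, R) \<Rightarrow> L \<noteq> {} \<and> L \<subset> {1..r} \<and> R \<noteq> {} \<and> R \<subset> {1..r})"

(* Complements are relative to {1..r}.  The result relates only subsets of
   {1..r} whenever all members of the list C are congruences on {1..r}. *)
inductive deducible :: "nat \<Rightarrow> congruence list \<Rightarrow> nat set \<Rightarrow> nat set \<Rightarrow> bool"
  for r :: nat and C :: "congruence list" where
  incl: "L \<subseteq> R \<Longrightarrow> R \<subseteq> {1..r} \<Longrightarrow> deducible r C L R"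
| fwd: "(L, R) \<in> set C \<Longrightarrow> deducible r C L R"
| bwd: "(L, R) \<in> set C \<Longrightarrow> deducible r C R L"
| compl_fwd: "(L, R) \<in> set C \<Longrightarrow> deducible r C ({1..r} - L) ({1..r} - R)"
| compl_bwd: "(L, R) \<in> set C \<Longrightarrow> deducible r C ({1..r} - R) ({1..r} - L)"
| trans: "deducible r C K L \<Longrightarrow> deducible r C L M \<Longrightarrow> deducible r C K M"

definition consistent_system :: "nat \<Rightarrow> congruence list \<Rightarrow> bool" where
  "consistent_system r C \<longleftrightarrow>
     \<not> (\<exists>L R. L \<subseteq> {1..r} \<and> R \<subset> L \<and> deducible r C L R)"

end

theory Submission
  imports Defs
begin

text \<open>Call two sets of indices equivalent if each is deducible from the other. Consistency says that
in the deducibility order a set is never below a proper subset of itself, so a chain of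
congruences and inclusions that returns to its starting point consists of equalities.
Equivalence respects complements. In every class of complementary pairs of sets one pair is
chosen as root. To realise all the given congruences it suffices to realise one congruence from
the root to every other pair of the class, and, if the class contains the complement of its root
\<open>q\<close>, the single congruence of \<open>q\<close> to its complement
(\<open>letters_generate\<close>). The former are witnessed by isometries of infinite order, the
latter by involutions, all of them independent: reduced words in these letters are never the
identity. With an isometry of infinite order in place of an involution, the path of its iterates
would alternate between \<open>q\<close> and its complement and remember its first step forever,
which the construction below does not allow.

Independence comes from arithmetic (\<open>exists_free_reflections\<close>). Modulo a prime
\<open>p\<close>, the reflection in an isotropic integer vector \<open>u\<close> becomes, after
clearing denominators, a multiple of the map \<open>x \<mapsto> (u \<bullet> x) u\<close>.
Distinct points of the conic of isotropic lines are not orthogonal, so a reduced word in such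
reflections does not vanish modulo \<open>p\<close>, whereas a cleared identity would. As every
nontrivial word fixes only a nowhere dense subset of the sphere, the points moved by every such
word form a comeager invariant set, and on it every orbit is a tree whose edges are the letters.

The sets \<open>A k\<close> are a colouring of these trees, subject on each edge to the
condition that the one end lies in the source of the letter exactly if the other end lies in its
target. The key point is that long paths forget (\<open>long_words_linked\<close>). Following
the set of colours possible at the far end of a path, either it eventually is everything or the
path gives a long chain in the deducibility order. A long chain repeats, so by consistency it
contains four consecutive congruences joined by equalities; but the letters form a star with at
most a loop at its centre, in which no reduced walk has four edges.

Since an orbit may return to an open set infinitely often, a small open set cannot be coloured
without regard to the coloured points already on the same tree. The partial colourings are kept
such that coloured points at small distance have a coloured path between them, and that every
sufficiently long path gets away from the coloured points. To colour one more point, all points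
that can be reached from it while staying near coloured points are coloured with it. These are
finitely many, by the second condition; by the first, different coloured regions adjacent to
them are further apart than the memory of the constraints, so that the constraints never
interact (\<open>compatible_step\<close>). Translating a tiny neighbourhood of the point, whose
returns to itself take very long words, extends the open sets (\<open>local_extension\<close>).
Countably many such steps make the union dense and use every colour
(\<open>exists_dense_colouring\<close>).\<close>

section \<open>Reduced words acting freely on a dense set\<close>

definition reduced :: "('s \<Rightarrow> 's) \<Rightarrow> 's list \<Rightarrow> bool" where
  "reduced iv = successively (\<lambda>s t. s \<noteq> iv t)"

text \<open>The involution \<open>iv\<close> sends a letter to the letter of the inverse map. It may fix
a letter, which then acts as an involution, so the group is a free product of infinite
cyclic groups and groups of order two. On \<open>Y\<close> it acts freely, and the orbit of
a point of \<open>Y\<close> is a tree in which paths are reduced words. The last assumption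
excludes finite trees: it supplies points far away from a sparse set.\<close>

locale free_action =
  fixes X :: "'a::euclidean_space set" and Y :: "'a set"
    and Al :: "'s set" and iv :: "'s \<Rightarrow> 's" and f :: "'s \<Rightarrow> 'a \<Rightarrow> 'a"
  assumes finite_Al: "finite Al"
    and iv_Al: "s \<in> Al \<Longrightarrow> iv s \<in> Al"
    and iv_iv: "iv (iv s) = s"
    and f_X: "s \<in> Al \<Longrightarrow> x \<in> X \<Longrightarrow> f s x \<in> X"
    and f_iv: "s \<in> Al \<Longrightarrow> x \<in> X \<Longrightarrow> f (iv s) (f s x) = x"
    and f_dist: "s \<in> Al \<Longrightarrow> x \<in> X \<Longrightarrow> y \<in> X \<Longrightarrow> dist (f s x) (f s y) = dist x y"
    and X_nonempty: "X \<noteq> {}"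
    and Y_X: "Y \<subseteq> X"
    and f_Y: "s \<in> Al \<Longrightarrow> y \<in> Y \<Longrightarrow> f s y \<in> Y"
    and Y_dense: "openin (top_of_set X) U \<Longrightarrow> U \<noteq> {} \<Longrightarrow> U \<inter> Y \<noteq> {}"
    and free: "y \<in> Y \<Longrightarrow> w \<in> lists Al \<Longrightarrow> reduced iv w \<Longrightarrow> w \<noteq> [] \<Longrightarrow> foldr f w y \<noteq> y"
    and long_words: "\<exists>w \<in> lists Al. reduced iv w \<and> length w = n"
begin

abbreviation act :: "'s list \<Rightarrow> 'a \<Rightarrow> 'a" where "act \<equiv> foldr f"
abbreviation winv :: "'s list \<Rightarrow> 's list" where "winv w \<equiv> rev (map iv w)"

definition reduced_words :: "'s list set" where "reduced_words = {w \<in> lists Al. reduced iv w}"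

lemma reduced_words_Nil [simp]: "[] \<in> reduced_words"
  by (simp add: reduced_words_def reduced_def)

lemma reduced_words_lists: "w \<in> reduced_words \<Longrightarrow> w \<in> lists Al"
  by (simp add: reduced_words_def)

lemma reduced_words_append_iff:
  "u @ v \<in> reduced_words \<longleftrightarrow> u \<in> reduced_words \<and> v \<in> reduced_words \<and> (u \<noteq> [] \<longrightarrow> v \<noteq> [] \<longrightarrow> last u \<noteq> iv (hd v))"
  by (auto simp: reduced_words_def reduced_def successively_append_iff)

lemma reduced_words_Cons_iff: "s # w \<in> reduced_words \<longleftrightarrow> s \<in> Al \<and> w \<in> reduced_words \<and> (w \<noteq> [] \<longrightarrow> s \<noteq> iv (hd w))"
  by (auto simp: reduced_words_def reduced_def successively_Cons)

lemma winv_lists: "w \<in> lists Al \<Longrightarrow> winv w \<in> lists Al"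
  using iv_Al by (auto simp: in_lists_conv_set)

lemma winv_winv [simp]: "winv (winv w) = w"
  by (simp add: rev_map map_idI iv_iv)

lemma winv_reduced_words: "w \<in> reduced_words \<Longrightarrow> winv w \<in> reduced_words"
proof (induction w)
  case Nil
  then show ?case by simp
next
  case (Cons s w)
  then have "winv w \<in> reduced_words" "s \<in> Al" "w \<noteq> [] \<Longrightarrow> s \<noteq> iv (hd w)"
    by (auto simp: reduced_words_Cons_iff)
  moreover have "[iv s] \<in> reduced_words"
    using \<open>s \<in> Al\<close> iv_Al by (simp add: reduced_words_Cons_iff)
  moreover have "winv w \<noteq> [] \<Longrightarrow> last (winv w) = iv (hd w)"
    by (simp add: last_rev hd_map)
  ultimately show ?case
    by (auto simp: reduced_words_append_iff iv_iv)
qed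

lemma act_X: "w \<in> lists Al \<Longrightarrow> x \<in> X \<Longrightarrow> act w x \<in> X"
  by (induction w) (auto simp: f_X)

lemma act_Y: "w \<in> lists Al \<Longrightarrow> x \<in> Y \<Longrightarrow> act w x \<in> Y"
  by (induction w) (auto simp: f_Y)

lemma act_dist: "w \<in> lists Al \<Longrightarrow> x \<in> X \<Longrightarrow> y \<in> X \<Longrightarrow> dist (act w x) (act w y) = dist x y"
  by (induction w) (auto simp: f_dist act_X)

lemma act_winv: "w \<in> lists Al \<Longrightarrow> x \<in> X \<Longrightarrow> act (winv w) (act w x) = x"
  by (induction w arbitrary: x) (auto simp: f_iv act_X)

lemma act_winv': "w \<in> lists Al \<Longrightarrow> x \<in> X \<Longrightarrow> act w (act (winv w) x) = x"
  using act_winv[of "winv w" x] winv_lists[of w] by simp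

lemma exists_reduced_word:
  "w \<in> lists Al \<Longrightarrow> \<exists>w'\<in>reduced_words. length w' \<le> length w \<and> (\<forall>x\<in>X. act w' x = act w x)"
proof (induction w)
  case Nil
  then show ?case by (intro bexI[of _ "[]"]) auto
next
  case (Cons s w)
  then obtain w' where w': "w' \<in> reduced_words" "length w' \<le> length w" "\<forall>x\<in>X. act w' x = act w x"
    by auto
  have s: "s \<in> Al" using Cons by auto
  show ?case
  proof (cases "w' \<noteq> [] \<and> s = iv (hd w')")
    case True
    then obtain t w'' where t: "w' = t # w''" "s = iv t" by (cases w') auto
    then have "w'' \<in> reduced_words" "t \<in> Al" using w' by (auto simp: reduced_words_Cons_iff)
    moreover have "act w'' x = act (s # w) x" if "x \<in> X" for x
    proof -
      have "act w x = f t (act w'' x)" using w'(3) that t by auto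
      then show ?thesis
        using f_iv[of t "act w'' x"] t act_X that \<open>w'' \<in> reduced_words\<close> \<open>t \<in> Al\<close> reduced_words_lists by auto
    qed
    ultimately show ?thesis using w' t by (intro bexI[of _ w'']) auto
  next
    case False
    then have "s # w' \<in> reduced_words" using w' s by (auto simp: reduced_words_Cons_iff)
    then show ?thesis using w' by (intro bexI[of _ "s # w'"]) auto
  qed
qed

text \<open>If two reduced words begin differently, the inverse of one followed by the other is again
reduced, so freeness applies to it.\<close>

lemma act_inj:
  "u \<in> reduced_words \<Longrightarrow> v \<in> reduced_words \<Longrightarrow> y \<in> Y \<Longrightarrow> act u y = act v y \<Longrightarrow> u = v"
proof (induction u arbitrary: v)
  case Nil
  then show ?case using free[of y v] by (auto simp: reduced_words_def)
next
  case (Cons s u)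
  have us: "s \<in> Al" "u \<in> reduced_words" using Cons.prems by (auto simp: reduced_words_Cons_iff)
  show ?case
  proof (cases v)
    case Nil
    then show ?thesis using Cons.prems free[of y "s # u"] by (auto simp: reduced_words_def)
  next
    case (Cons t v')
    have tv: "t \<in> Al" "v' \<in> reduced_words" using Cons.prems Cons by (auto simp: reduced_words_Cons_iff)
    have YX: "act u y \<in> X" "act v' y \<in> X" "y \<in> X"
      using act_X us tv Y_X Cons.prems reduced_words_lists by blast+
    show ?thesis
    proof (cases "s = t")
      case True
      have "act u y = f (iv s) (f s (act u y))" using f_iv us YX by simp
      also have "\<dots> = f (iv s) (f s (act v' y))" using Cons.prems Cons True by simp
      also have "\<dots> = act v' y" using f_iv us YX by simp
      finally show ?thesis using Cons.IH[of v'] us tv Cons.prems(3) Cons True by blast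
    next
      case False
      have "winv v @ (s # u) \<in> reduced_words"
        using Cons.prems(1,2) winv_reduced_words[of v] Cons False iv_iv
        by (subst reduced_words_append_iff) (metis append_Nil2 last_snoc list.sel(1) list.simps(9) rev.simps(2))
      moreover have "act (winv v @ (s # u)) y = y"
        using Cons.prems(2,4) act_winv[of v y] YX reduced_words_lists by simp
      ultimately show ?thesis using free[of y "winv v @ (s # u)"] Cons.prems(3)
        by (auto simp: reduced_words_def)
    qed
  qed
qed

lemma reduced_word_shortest:
  assumes "u \<in> reduced_words" "w \<in> lists Al" "y \<in> Y" "act u y = act w y"
  shows "length u \<le> length w"
  using exists_reduced_word[OF assms(2)] act_inj[OF assms(1) _ assms(3)] assms Y_X
  by (metis subsetD)

lemma openin_act_image:
  assumes "w \<in> lists Al" "openin (top_of_set X) U"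
  shows "openin (top_of_set X) (act w ` U)"
proof -
  have U: "U \<subseteq> X" using assms(2) openin_imp_subset by auto
  have eq: "act w ` U = X \<inter> act (winv w) -` U"
    using act_winv[OF assms(1)] act_winv'[OF assms(1)] act_X[OF assms(1)] U
      act_X[OF winv_lists[OF assms(1)]] by (force simp: image_iff)
  have "continuous_on X (act (winv w))"
    unfolding continuous_on_iff
    by (metis act_dist[OF winv_lists[OF assms(1)]])
  then show ?thesis
    unfolding eq using act_X[OF winv_lists[OF assms(1)]] assms(2)
    by (intro continuous_openin_preimage[of X _ X]) auto
qed

lemma finite_short_reduced_words: "finite {w \<in> reduced_words. length w \<le> n}"
  by (rule finite_subset[OF _ finite_lists_length_le[OF finite_Al, of n]])
    (auto simp: reduced_words_def in_lists_conv_set)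

end

section \<open>Colouring orbits one small open set at a time\<close>

text \<open>A path spelled by \<open>w\<close>, read from the end of the list, can be coloured when its
first point has colour \<open>a\<close> and its last point has colour \<open>c\<close>.\<close>

primrec linked :: "'c set \<Rightarrow> ('s \<Rightarrow> 'c \<Rightarrow> 'c \<Rightarrow> bool) \<Rightarrow> 's list \<Rightarrow> 'c \<Rightarrow> 'c \<Rightarrow> bool" where
  "linked N valid [] a c = (a = c)"
| "linked N valid (s # w) a c = (\<exists>b\<in>N. linked N valid w a b \<and> valid s b c)"

lemma linked_append:
  "c \<in> N \<Longrightarrow> linked N valid (u @ v) a c \<longleftrightarrow> (\<exists>b\<in>N. linked N valid v a b \<and> linked N valid u b c)"
  by (induction u arbitrary: c) auto

text \<open>\<open>valid s a b\<close> allows the colours \<open>a\<close> and \<open>b\<close> at the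
ends of an edge labelled \<open>s\<close>. By the last assumption a path of length
\<open>m\<close> transmits no information about its first colour.\<close>

locale edge_colouring = free_action X Y Al iv f
  for X Y :: "'a::euclidean_space set" and Al :: "'s set" and iv f +
  fixes N :: "'c set" and valid :: "'s \<Rightarrow> 'c \<Rightarrow> 'c \<Rightarrow> bool" and m :: nat
  assumes finite_N: "finite N" and N_nonempty: "N \<noteq> {}"
    and valid_iv: "s \<in> Al \<Longrightarrow> a \<in> N \<Longrightarrow> b \<in> N \<Longrightarrow> valid (iv s) b a \<longleftrightarrow> valid s a b"
    and valid_total: "s \<in> Al \<Longrightarrow> a \<in> N \<Longrightarrow> \<exists>b\<in>N. valid s a b"
    and m_ge_2: "2 \<le> m"
    and long_linked: "w \<in> reduced_words \<Longrightarrow> m \<le> length w \<Longrightarrow> a \<in> N \<Longrightarrow> c \<in> N \<Longrightarrow> linked N valid w a c"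
begin

definition coloured :: "('c \<Rightarrow> 'a set) \<Rightarrow> 'a set" where
  "coloured A = (\<Union>k\<in>N. A k)"

text \<open>The radius is twice the memory of a path: two coloured points that both constrain a third
one are at distance less than \<open>2 * m\<close>.\<close>

definition near :: "('c \<Rightarrow> 'a set) \<Rightarrow> 'a \<Rightarrow> bool" where
  "near A z \<longleftrightarrow> (\<exists>u\<in>reduced_words. length u \<le> 2 * m \<and> act u z \<in> coloured A)"

definition proper_colouring :: "('c \<Rightarrow> 'a set) \<Rightarrow> bool" where
  "proper_colouring A \<longleftrightarrow>
     (\<forall>k\<in>N. openin (top_of_set X) (A k)) \<and>
     (\<forall>y\<in>Y. \<forall>j\<in>N. \<forall>k\<in>N. y \<in> A j \<longrightarrow> y \<in> A k \<longrightarrow> j = k) \<and>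
     (\<forall>y\<in>Y. \<forall>s\<in>Al. \<forall>j\<in>N. \<forall>k\<in>N. y \<in> A j \<longrightarrow> f s y \<in> A k \<longrightarrow> valid s j k)"

text \<open>This keeps the constraints imposed on an uncoloured point by its surroundings independent:
at distance less than \<open>m\<close> there is at most one coloured point visible from it.\<close>

definition locally_convex :: "('c \<Rightarrow> 'a set) \<Rightarrow> bool" where
  "locally_convex A \<longleftrightarrow> (\<forall>y\<in>Y. \<forall>u v. u @ v \<in> reduced_words \<longrightarrow> length (u @ v) \<le> 2 * m \<longrightarrow>
     y \<in> coloured A \<longrightarrow> act (u @ v) y \<in> coloured A \<longrightarrow> act v y \<in> coloured A)"

text \<open>This bounds the region that has to be coloured together with a new point.\<close>

definition sparse :: "('c \<Rightarrow> 'a set) \<Rightarrow> nat \<Rightarrow> bool" where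
  "sparse A n \<longleftrightarrow> (\<forall>y\<in>Y. \<forall>w\<in>reduced_words. length w = n \<longrightarrow>
     (\<exists>u v. w = u @ v \<and> \<not> near A (act v y)))"

definition admissible :: "('c \<Rightarrow> 'a set) \<Rightarrow> bool" where
  "admissible A \<longleftrightarrow> proper_colouring A \<and> locally_convex A \<and> (\<exists>n. sparse A n)"

text \<open>These words lead to the coloured points visible from \<open>x\<close>.\<close>

definition first_hit :: "('c \<Rightarrow> 'a set) \<Rightarrow> 'a \<Rightarrow> 's list \<Rightarrow> bool" where
  "first_hit A x w \<longleftrightarrow> w \<in> reduced_words \<and> act w x \<in> coloured A \<and>
     (\<forall>u v. w = u @ v \<longrightarrow> u \<noteq> [] \<longrightarrow> act v x \<notin> coloured A)"

text \<open>The colour \<open>b\<close> at the point reached by \<open>w\<close> is not in conflict with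
the visible coloured points that are still within the range of memory beyond
\<open>w\<close>.\<close>

definition compatible :: "('c \<Rightarrow> 'a set) \<Rightarrow> 'a \<Rightarrow> 's list \<Rightarrow> 'c \<Rightarrow> bool" where
  "compatible A x w b \<longleftrightarrow> (\<forall>u k. first_hit A x (u @ w) \<longrightarrow> length u < m \<longrightarrow> k \<in> N \<longrightarrow>
     act (u @ w) x \<in> A k \<longrightarrow> linked N valid u b k)"

text \<open>In a tree, two paths from \<open>x\<close> that separate at the point reached by
\<open>w\<close> form together the path between their ends, which therefore passes through
that point.\<close>

lemma fork_point_coloured:
  assumes A: "locally_convex A" and x: "x \<in> Y"
    and u: "u @ w \<in> reduced_words" "act (u @ w) x \<in> coloured A"
    and v: "v @ w \<in> reduced_words" "act (v @ w) x \<in> coloured A"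
    and len: "length u + length v \<le> 2 * m"
    and fork: "u = [] \<or> v = [] \<or> last u \<noteq> last v"
  shows "act w x \<in> coloured A"
proof (cases "u = [] \<or> v = []")
  case True
  then show ?thesis using u v by auto
next
  case False
  have uv: "u \<in> reduced_words" "v \<in> reduced_words" "w \<in> reduced_words" using u v by (auto simp: reduced_words_append_iff)
  have y: "act w x \<in> X" "act (u @ w) x \<in> Y"
    using act_Y u x Y_X uv reduced_words_lists by blast+
  have "hd (winv u) = iv (last u)"
    using False by (simp add: hd_rev last_map)
  then have "v @ winv u \<in> reduced_words"
    using uv winv_reduced_words[of u] fork False by (auto simp: reduced_words_append_iff iv_iv)
  moreover have w: "act (winv u) (act (u @ w) x) = act w x"
    using act_winv[of u "act w x"] uv reduced_words_lists y by simp
  then have "act (v @ winv u) (act (u @ w) x) \<in> coloured A"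
    using v by simp
  ultimately have "act (winv u) (act (u @ w) x) \<in> coloured A"
    using A y u(2) len unfolding locally_convex_def by auto
  then show ?thesis using w by simp
qed

lemma first_hit_unique:
  assumes "locally_convex A" "x \<in> Y"
    and u: "first_hit A x (u @ w)" and v: "first_hit A x (v @ w)"
    and "length u \<le> m" "length v \<le> m"
  shows "u = v"
proof -
  obtain c u' v' where c: "u = u' @ c" "v = v' @ c" "u' = [] \<or> v' = [] \<or> last u' \<noteq> last v'"
    using longest_common_suffix by blast
  have "act (c @ w) x \<in> coloured A"
    by (rule fork_point_coloured[of A x u' "c @ w" v'])
      (use assms c in \<open>auto simp: first_hit_def\<close>)
  then have "u' = []" "v' = []"
    using u v c unfolding first_hit_def by (metis append.assoc)+
  then show ?thesis using c by simp
qed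

lemma linked_from: "w \<in> reduced_words \<Longrightarrow> c \<in> N \<Longrightarrow> \<exists>a\<in>N. linked N valid w a c"
proof (induction w arbitrary: c)
  case Nil
  then show ?case by auto
next
  case (Cons s w)
  then have s: "s \<in> Al" "w \<in> reduced_words" by (auto simp: reduced_words_Cons_iff)
  then obtain b where "b \<in> N" "valid (iv s) c b"
    using valid_total[of "iv s" c] iv_Al Cons.prems by auto
  then have "valid s b c" using valid_iv[of s b c] s Cons.prems by auto
  then show ?case using Cons.IH[of b] s \<open>b \<in> N\<close> by auto
qed

lemma exists_compatible:
  assumes "proper_colouring A" "locally_convex A" "x \<in> Y"
  shows "\<exists>a\<in>N. compatible A x [] a"
proof (cases "\<exists>u. first_hit A x u \<and> length u < m")
  case True
  then obtain u where u: "first_hit A x u" "length u < m" by auto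
  then obtain k where k: "k \<in> N" "act u x \<in> A k"
    by (auto simp: first_hit_def coloured_def)
  obtain a where a: "a \<in> N" "linked N valid u a k"
    using linked_from[of u k] u k by (auto simp: first_hit_def)
  have "act u x \<in> Y" using act_Y assms u reduced_words_lists by (auto simp: first_hit_def)
  then have "compatible A x [] a"
    using first_hit_unique[of A x u "[]"] u k a assms
    unfolding compatible_def proper_colouring_def by (metis append.right_neutral less_imp_le)
  then show ?thesis using a by auto
next
  case False
  then show ?thesis using N_nonempty by (auto simp: compatible_def)
qed

end

text \<open>One step of the construction: the point \<open>x0\<close> is to receive the colour
\<open>a0\<close>. The open set \<open>V\<close> is so small that its points see the same
pattern of colours up to the distance that matters, and that two of its points on the same
orbit are very far apart.\<close>

locale extension_step = edge_colouring X Y Al iv f N valid m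
  for X Y :: "'a::euclidean_space set" and Al :: "'s set" and iv f
    and N :: "'c set" and valid m +
  fixes A :: "'c \<Rightarrow> 'a set" and n :: nat and x0 :: 'a and a0 :: 'c and V :: "'a set"
  assumes proper_A: "proper_colouring A" and convex_A: "locally_convex A" and sparse_A: "sparse A n"
    and x0_Y: "x0 \<in> Y" and x0_new: "x0 \<notin> coloured A"
    and a0_N: "a0 \<in> N" and a0_compatible: "compatible A x0 [] a0"
    and V_open: "openin (top_of_set X) V" and x0_V: "x0 \<in> V"
    and same_pattern: "y \<in> V \<Longrightarrow> w \<in> reduced_words \<Longrightarrow> length w \<le> n + 2 * m + 1 \<Longrightarrow> k \<in> N \<Longrightarrow>
      act w y \<in> A k \<longleftrightarrow> act w x0 \<in> A k"
    and no_return: "y \<in> V \<Longrightarrow> w \<in> reduced_words \<Longrightarrow> w \<noteq> [] \<Longrightarrow> length w \<le> 6 * n + 8 * m + 1 \<Longrightarrow> act w y \<notin> V"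
begin

text \<open>The words leading to the points that are coloured together with \<open>x0\<close>.
Continuing a branch until it has left the neighbourhood of the coloured points makes the
extended colouring locally convex without any iteration.\<close>

definition cluster :: "'s list set" where
  "cluster = {w \<in> reduced_words. \<forall>u v. w = u @ v \<longrightarrow>
     act v x0 \<notin> coloured A \<and> (v = [] \<or> near A (act v x0))}"

primrec cluster_colour :: "'s list \<Rightarrow> 'c" where
  "cluster_colour [] = a0"
| "cluster_colour (s # w) =
     (SOME b. b \<in> N \<and> valid s (cluster_colour w) b \<and> compatible A x0 (s # w) b)"

definition extended :: "'c \<Rightarrow> 'a set" where
  "extended k = A k \<union> (\<Union>w\<in>{w \<in> cluster. cluster_colour w = k}. act w ` V)"

lemma V_X: "V \<subseteq> X"
  using V_open openin_imp_subset by blast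

lemma cluster_reduced_words: "w \<in> cluster \<Longrightarrow> w \<in> reduced_words"
  by (simp add: cluster_def)

lemma cluster_lists: "w \<in> cluster \<Longrightarrow> w \<in> lists Al"
  by (simp add: cluster_reduced_words reduced_words_lists)

lemma Nil_cluster: "[] \<in> cluster"
  using x0_new by (simp add: cluster_def)

lemma cluster_suffix: "u @ v \<in> cluster \<Longrightarrow> v \<in> cluster"
  by (auto simp: cluster_def reduced_words_append_iff)

lemma cluster_new: "w \<in> cluster \<Longrightarrow> act w x0 \<notin> coloured A"
  by (auto simp: cluster_def)

lemma cluster_Cons:
  "w \<in> cluster \<Longrightarrow> s # w \<in> reduced_words \<Longrightarrow> act (s # w) x0 \<notin> coloured A \<Longrightarrow> near A (act (s # w) x0) \<Longrightarrow>
   s # w \<in> cluster"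
  by (auto simp: cluster_def Cons_eq_append_conv)

lemma first_hit_Cons:
  "w \<in> cluster \<Longrightarrow> s # w \<in> reduced_words \<Longrightarrow> act (s # w) x0 \<in> coloured A \<Longrightarrow> first_hit A x0 (s # w)"
  by (auto simp: cluster_def first_hit_def Cons_eq_append_conv)

text \<open>A longer branch would contain a path of length \<open>n\<close> all of whose points are near
coloured ones.\<close>

lemma cluster_length: "w \<in> cluster \<Longrightarrow> length w \<le> n"
proof (rule ccontr)
  assume w: "w \<in> cluster" "\<not> length w \<le> n"
  \<comment> \<open>The last \<open>n + 1\<close> letters are the part of the branch next to
      \<open>x0\<close>. The letter applied first is split off, because
      \<open>x0\<close> itself need not be near a coloured point.\<close>
  define p where "p = drop (length w - Suc n) w"
  have p: "p \<in> cluster" "length p = Suc n"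
    using w cluster_suffix[of "take (length w - Suc n) w" p] by (auto simp: p_def)
  then obtain q s where qs: "p = q @ [s]" "length q = n"
    by (cases p rule: rev_cases) auto
  then have "q \<in> reduced_words" "s \<in> Al" "f s x0 \<in> Y"
    using p cluster_reduced_words[of p] x0_Y f_Y by (auto simp: reduced_words_append_iff reduced_words_Cons_iff)
  then obtain u v where "q = u @ v" "\<not> near A (act v (f s x0))"
    using sparse_A qs unfolding sparse_def by blast
  moreover have "near A (act (v @ [s]) x0)"
  proof -
    have "p = u @ (v @ [s])" using qs \<open>q = u @ v\<close> by simp
    then show ?thesis using p(1) unfolding cluster_def by blast
  qed
  ultimately show False by simp
qed

text \<open>Beyond the next point at most one coloured point is visible within the range of memory. If
it was within range before, the compatible colour \<open>a\<close> determines how to proceed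
towards it; if it has just come into range, the path to it has length \<open>m\<close>, and
every colour can be joined to it.\<close>

lemma compatible_step:
  assumes w: "w \<in> cluster" and s: "s # w \<in> reduced_words"
    and a: "a \<in> N" "compatible A x0 w a"
  shows "\<exists>b\<in>N. valid s a b \<and> compatible A x0 (s # w) b"
proof (cases "\<exists>u. first_hit A x0 (u @ s # w) \<and> length u < m")
  case True
  then obtain u where u: "first_hit A x0 (u @ s # w)" "length u < m" by auto
  then obtain k where k: "k \<in> N" "act (u @ s # w) x0 \<in> A k"
    by (auto simp: first_hit_def coloured_def)
  have usw: "u @ s # w \<in> reduced_words" "(u @ [s]) @ w \<in> reduced_words" using u by (auto simp: first_hit_def)
  have "linked N valid (u @ [s]) a k"
  proof (cases "length (u @ [s]) < m")
    case True
    then show ?thesis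
      using a(2) u(1) k unfolding compatible_def
      by (metis append.assoc append_Cons append_Nil)
  next
    case False
    then show ?thesis
      using long_linked[of "u @ [s]" a k] usw(2) a k reduced_words_append_iff by (metis not_less)
  qed
  then obtain b where b: "b \<in> N" "valid s a b" "linked N valid u b k"
    using linked_append[of k N valid u "[s]" a] k a by auto
  have "act (u @ s # w) x0 \<in> Y" using act_Y x0_Y usw reduced_words_lists by blast
  then have "compatible A x0 (s # w) b"
    using first_hit_unique[OF convex_A x0_Y u(1)] u k b proper_A
    unfolding compatible_def proper_colouring_def by (metis less_imp_le)
  then show ?thesis using b by blast
next
  case False
  have "s \<in> Al" using s by (simp add: reduced_words_Cons_iff)
  then obtain b where "b \<in> N" "valid s a b" using valid_total a by blast
  then show ?thesis using False by (auto simp: compatible_def)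
qed

lemma cluster_colour_step:
  assumes "w \<in> cluster" "s # w \<in> reduced_words" "cluster_colour w \<in> N" "compatible A x0 w (cluster_colour w)"
  shows "cluster_colour (s # w) \<in> N \<and> valid s (cluster_colour w) (cluster_colour (s # w)) \<and>
    compatible A x0 (s # w) (cluster_colour (s # w))"
  unfolding cluster_colour.simps
  by (rule someI_ex) (use compatible_step[OF assms] in blast)

lemma cluster_colour_compatible:
  "w \<in> cluster \<Longrightarrow> cluster_colour w \<in> N \<and> compatible A x0 w (cluster_colour w)"
proof (induction w)
  case Nil
  then show ?case by (simp add: a0_N a0_compatible)
next
  case (Cons s w)
  have "w \<in> cluster" using cluster_suffix[of "[s]" w] Cons.prems by simp
  then show ?case using Cons cluster_colour_step cluster_reduced_words by blast
qed

lemma cluster_colour_N: "w \<in> cluster \<Longrightarrow> cluster_colour w \<in> N"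
  using cluster_colour_compatible by blast

lemma cluster_colour_valid:
  assumes "s # w \<in> cluster"
  shows "valid s (cluster_colour w) (cluster_colour (s # w))"
proof -
  have "w \<in> cluster" using cluster_suffix[of "[s]" w] assms by simp
  then show ?thesis using cluster_colour_step cluster_colour_compatible cluster_reduced_words assms by blast
qed

lemma cluster_colour_boundary:
  assumes "w \<in> cluster" "s # w \<in> reduced_words" "k \<in> N" "act (s # w) x0 \<in> A k"
  shows "valid s (cluster_colour w) k"
proof -
  have "first_hit A x0 ([s] @ w)"
    using first_hit_Cons[OF assms(1,2)] assms(3,4) by (auto simp: coloured_def)
  then have "linked N valid [s] (cluster_colour w) k"
    using cluster_colour_compatible[OF assms(1)] assms m_ge_2
    unfolding compatible_def by fastforce
  then show ?thesis by auto
qed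

text \<open>A word bringing a point of \<open>V\<close> back to \<open>V\<close> reduces to the empty
word.\<close>

lemma return_unique:
  assumes "y \<in> V" "act x y \<in> V" "x \<in> lists Al" "length x \<le> 6 * n + 8 * m + 1"
  shows "act x y = y"
proof -
  obtain x' where "x' \<in> reduced_words" "length x' \<le> length x" "\<forall>z\<in>X. act x' z = act x z"
    using exists_reduced_word[OF assms(3)] by blast
  then show ?thesis using no_return[of y x'] assms V_X by (cases "x' = []") auto
qed

text \<open>Around every point of \<open>V\<close> the new colouring looks as it does around
\<open>x0\<close>, since other translates of \<open>V\<close> are too far away to interfere.
All properties of the new colouring can hence be checked at \<open>x0\<close>.\<close>

lemma extended_pattern:
  assumes y: "y \<in> V" "y \<in> Y" and w: "w \<in> reduced_words" "length w \<le> n + 2 * m + 1" and k: "k \<in> N"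
  shows "act w y \<in> extended k \<longleftrightarrow> act w x0 \<in> A k \<or> w \<in> cluster \<and> cluster_colour w = k"
proof
  assume "act w y \<in> extended k"
  then consider "act w y \<in> A k"
    | w' v where "w' \<in> cluster" "cluster_colour w' = k" "v \<in> V" "act w y = act w' v"
    by (auto simp: extended_def)
  then show "act w x0 \<in> A k \<or> w \<in> cluster \<and> cluster_colour w = k"
  proof cases
    case 1
    then show ?thesis using same_pattern[of y w k] y w k by blast
  next
    case 2
    have len: "length w' \<le> n" using 2 cluster_length by blast
    have wl: "w \<in> lists Al" "w' \<in> lists Al" using w 2 reduced_words_lists cluster_lists by auto
    have "v = act (winv w' @ w) y"
      using 2 act_winv[of w' v] wl V_X by auto
    then have "v = y"
      using return_unique[of y "winv w' @ w"] 2 y w len wl winv_lists by auto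
    then have "w = w'"
      using act_inj[of w w' y] 2 w y cluster_reduced_words by auto
    then show ?thesis using 2 by auto
  qed
next
  assume "act w x0 \<in> A k \<or> w \<in> cluster \<and> cluster_colour w = k"
  then show "act w y \<in> extended k"
    using same_pattern[of y w k] y w k by (auto simp: extended_def)
qed

lemma coloured_subset: "coloured A \<subseteq> coloured extended"
  by (auto simp: coloured_def extended_def)

lemma coloured_pattern:
  assumes "y \<in> V" "y \<in> Y" "w \<in> reduced_words" "length w \<le> n + 2 * m + 1"
  shows "act w y \<in> coloured extended \<longleftrightarrow> act w x0 \<in> coloured A \<or> w \<in> cluster"
  using extended_pattern[OF assms] cluster_colour_N by (auto simp: coloured_def)

lemma new_point:
  assumes "y \<in> Y" "y \<in> coloured extended" "y \<notin> coloured A"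
  obtains w v where "w \<in> cluster" "v \<in> V" "v \<in> Y" "y = act w v"
proof -
  obtain w v where w: "w \<in> cluster" "v \<in> V" "y = act w v"
    using assms by (auto simp: coloured_def extended_def)
  then have "v = act (winv w) y"
    using act_winv[of w v] V_X cluster_lists by auto
  then have "v \<in> Y" using act_Y assms w cluster_lists winv_lists by blast
  then show ?thesis using w that by blast
qed

lemma extended_disjoint:
  assumes "y \<in> Y" "j \<in> N" "k \<in> N" "y \<in> extended j" "y \<in> extended k"
  shows "j = k"
proof (cases "y \<in> coloured A")
  case True
  have "y \<in> A i" if i: "i \<in> N" "y \<in> extended i" for i
  proof (rule ccontr)
    assume "y \<notin> A i"
    then obtain w v where w: "w \<in> cluster" "v \<in> V" "y = act w v"
      using i by (auto simp: extended_def)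
    then have "act w x0 \<in> coloured A"
      using True same_pattern[of v w] cluster_reduced_words[of w] cluster_length[of w]
      by (auto simp: coloured_def)
    then show False using cluster_new w by blast
  qed
  then show ?thesis using assms proper_A unfolding proper_colouring_def by blast
next
  case False
  have "y \<in> coloured extended" using assms by (auto simp: coloured_def)
  then obtain w v where w: "w \<in> cluster" "v \<in> V" "v \<in> Y" "y = act w v"
    using new_point assms False by blast
  then have "act w v \<in> extended i \<longleftrightarrow> act w x0 \<in> A i \<or> cluster_colour w = i" if "i \<in> N" for i
    using extended_pattern[of v w i] cluster_reduced_words[of w] cluster_length[of w] that by auto
  then show ?thesis using assms w cluster_new by (auto simp: coloured_def)
qed

text \<open>The neighbour of a new point is a boundary point, a later point of the cluster, or the
preceding point of the cluster, according to whether the letter lengthens or cancels the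
word of the new point.\<close>

lemma extended_valid_new:
  assumes y: "y \<in> Y" "y \<notin> coloured A" and s: "s \<in> Al" and jk: "j \<in> N" "k \<in> N"
    and "y \<in> extended j" "f s y \<in> extended k"
  shows "valid s j k"
proof -
  obtain w v where w: "w \<in> cluster" "v \<in> V" "v \<in> Y" "y = act w v"
    using new_point[of y] assms by (auto simp: coloured_def)
  have len: "length w \<le> n" using w cluster_length by blast
  have j: "cluster_colour w = j"
    using extended_pattern[of v w j] w len cluster_reduced_words[of w] assms cluster_new[of w]
    by (auto simp: coloured_def)
  show ?thesis
  proof (cases "s # w \<in> reduced_words")
    case True
    then have "act (s # w) x0 \<in> A k \<or> s # w \<in> cluster \<and> cluster_colour (s # w) = k"
      using extended_pattern[of v "s # w" k] w len assms by auto
    then show ?thesis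
      using cluster_colour_valid[of s w] cluster_colour_boundary[of w s k] w jk j True by auto
  next
    case False
    then obtain t w' where t: "w = t # w'" "s = iv t"
      using cluster_reduced_words[of w] w s by (cases w) (auto simp: reduced_words_Cons_iff)
    have w': "w' \<in> cluster" using cluster_suffix[of "[t]" w'] w t by simp
    have tw: "t \<in> Al" "w' \<in> reduced_words" using cluster_reduced_words[of w] w t by (auto simp: reduced_words_Cons_iff)
    have "f s y = act w' v"
      using f_iv[of t "act w' v"] act_X[of w' v] tw w t V_X reduced_words_lists by auto
    then have "cluster_colour w' = k"
      using extended_pattern[of v w' k] w w' len t tw assms cluster_new[of w']
      by (auto simp: coloured_def)
    then show ?thesis
      using cluster_colour_valid[of t w'] w t j valid_iv[of t k j] tw jk by auto
  qed
qed

lemma extended_proper: "proper_colouring extended"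
  unfolding proper_colouring_def
proof (intro conjI ballI impI)
  fix k assume "k \<in> N"
  then show "openin (top_of_set X) (extended k)"
    unfolding extended_def
    using proper_A V_open openin_act_image cluster_lists
    by (intro openin_Un openin_Union) (auto simp: proper_colouring_def)
next
  fix y j k assume "y \<in> Y" "j \<in> N" "k \<in> N" "y \<in> extended j" "y \<in> extended k"
  then show "j = k" by (rule extended_disjoint)
next
  fix y s j k
  assume y: "y \<in> Y" and s: "s \<in> Al" and jk: "j \<in> N" "k \<in> N"
    and yj: "y \<in> extended j" and yk: "f s y \<in> extended k"
  have sy: "f s y \<in> Y" "f (iv s) (f s y) = y" using f_Y f_iv y s Y_X by auto
  show "valid s j k"
  proof (cases "y \<in> coloured A")
    case False
    then show ?thesis using extended_valid_new y s jk yj yk by blast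
  next
    case y_old: True
    show ?thesis
    proof (cases "f s y \<in> coloured A")
      case False
      then have "valid (iv s) k j"
        using extended_valid_new[of "f s y" "iv s" k j] sy s iv_Al jk yj yk by auto
      then show ?thesis using valid_iv s jk by blast
    next
      case True
      then obtain j' k' where "j' \<in> N" "k' \<in> N" "y \<in> A j'" "f s y \<in> A k'"
        using y_old by (auto simp: coloured_def)
      moreover from this have "j' = j" "k' = k"
        using extended_disjoint[of y j' j] extended_disjoint[of "f s y" k' k] y sy jk yj yk
        by (auto simp: extended_def)
      ultimately show ?thesis using proper_A y s unfolding proper_colouring_def by blast
    qed
  qed
qed

text \<open>Walking outwards from the cluster to a coloured point at small distance, every point is near
a coloured one. So the walk stays in the cluster until it hits a coloured point, and from
there on old local convexity takes over.\<close>

lemma cluster_union_convex: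
  assumes "u @ v @ w \<in> reduced_words" "w \<in> cluster" "length (u @ v) \<le> 2 * m"
    and "act (u @ v @ w) x0 \<in> coloured A \<or> u @ v @ w \<in> cluster"
  shows "act (v @ w) x0 \<in> coloured A \<or> v @ w \<in> cluster"
proof (cases "u @ v @ w \<in> cluster")
  case True
  then show ?thesis using cluster_suffix by blast
next
  case False
  then have end_old: "act (u @ v @ w) x0 \<in> coloured A" using assms by blast
  have "u @ v = p @ q \<Longrightarrow> act (q @ w) x0 \<in> coloured A \<or> q @ w \<in> cluster" for p q
  proof (induction q arbitrary: p)
    case Nil
    then show ?case using assms by simp
  next
    case (Cons s q)
    have reduced_words: "p @ s # q @ w \<in> reduced_words" using assms(1) Cons.prems
      by (metis append.assoc append_Cons)
    then have reduced_words': "s # q @ w \<in> reduced_words" "q @ w \<in> reduced_words" "p @ [s] \<in> reduced_words" "p \<in> reduced_words"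
      using reduced_words_append_iff[of p "s # q @ w"] reduced_words_append_iff[of "[s]" "q @ w"]
        reduced_words_append_iff[of "p @ [s]" "q @ w"] by auto
    have eq: "act (u @ v @ w) x0 = act (p @ [s]) (act (q @ w) x0)"
      "act (u @ v @ w) x0 = act p (act (s # q @ w) x0)"
      using arg_cong[OF Cons.prems, of "\<lambda>l. act (l @ w) x0"] by simp_all
    have len: "length p + Suc (length q) \<le> 2 * m"
      using arg_cong[OF Cons.prems, of length] assms(3) by simp
    have Y: "act (q @ w) x0 \<in> Y" using act_Y x0_Y reduced_words' reduced_words_lists by blast
    have "act (q @ w) x0 \<in> coloured A \<or> q @ w \<in> cluster"
      using Cons.IH[of "p @ [s]"] Cons.prems by simp
    then show ?case
    proof
      assume "act (q @ w) x0 \<in> coloured A"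
      then have "act [s] (act (q @ w) x0) \<in> coloured A"
        using convex_A Y end_old eq(1) reduced_words'(3) len unfolding locally_convex_def by fastforce
      then show ?thesis by simp
    next
      assume "q @ w \<in> cluster"
      moreover have "near A (act (s # q @ w) x0)"
        unfolding near_def using eq(2) end_old reduced_words'(4) len by (intro bexI[of _ p]) auto
      ultimately show ?thesis
        using cluster_Cons[of "q @ w" s] reduced_words' by auto
    qed
  qed
  then show ?thesis by blast
qed

text \<open>The path first runs back inside the cluster, as long as its letters cancel against
\<open>w\<close>, and then leaves it along a reduced word.\<close>

lemma convex_from_new:
  assumes y: "y \<in> Y" "y \<in> coloured extended" "y \<notin> coloured A"
    and uv: "u @ v \<in> reduced_words" "length (u @ v) \<le> 2 * m" "act (u @ v) y \<in> coloured extended"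
  shows "act v y \<in> coloured extended"
proof -
  obtain w v0 where w: "w \<in> cluster" "v0 \<in> V" "v0 \<in> Y" "y = act w v0"
    using new_point y by blast
  have "act v (act w v0) \<in> coloured extended"
    if "u @ v \<in> reduced_words" "w \<in> cluster" "length (u @ v) \<le> 2 * m"
      "act (u @ v) (act w v0) \<in> coloured extended" for u v w
    using that
  proof (induction v arbitrary: w rule: rev_induct)
    case Nil
    then show ?case
      using coloured_pattern[of v0 w] w cluster_reduced_words[of w] cluster_length[of w] by auto
  next
    case (snoc s v)
    have len: "length w \<le> n" using snoc.prems cluster_length by blast
    have wR: "w \<in> reduced_words" using snoc.prems cluster_reduced_words by blast
    have s: "s \<in> Al" using snoc.prems(1) by (auto simp: reduced_words_append_iff reduced_words_Cons_iff)
    show ?case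
    proof (cases "u @ (v @ [s]) @ w \<in> reduced_words")
      case True
      moreover from this have "(v @ [s]) @ w \<in> reduced_words" using reduced_words_append_iff by blast
      ultimately show ?thesis
        using coloured_pattern[of v0 "u @ (v @ [s]) @ w"] coloured_pattern[of v0 "(v @ [s]) @ w"]
          cluster_union_convex[of u "v @ [s]" w] snoc.prems w len by auto
    next
      case False
      then have "w \<noteq> []" "s = iv (hd w)"
        using snoc.prems(1) wR reduced_words_append_iff[of "u @ v @ [s]" w] by auto
      then obtain t w' where t: "w = t # w'" "s = iv t" by (cases w) auto
      have w': "w' \<in> cluster" "t \<in> Al" "w' \<in> lists Al"
        using cluster_suffix[of "[t]" w'] snoc.prems(2) t wR reduced_words_lists
        by (auto simp: reduced_words_Cons_iff)
      have "f s (act w v0) = act w' v0"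
        using f_iv[of t "act w' v0"] act_X[of w' v0] w' w t V_X by auto
      moreover have "u @ v \<in> reduced_words"
        using snoc.prems(1) reduced_words_append_iff[of "u @ v" "[s]"] by simp
      ultimately show ?thesis using snoc.IH[of w'] snoc.prems w' by auto
    qed
  qed
  then show ?thesis using uv w by blast
qed

lemma extended_convex: "locally_convex extended"
  unfolding locally_convex_def
proof (intro ballI allI impI)
  fix y u v
  assume y: "y \<in> Y" "y \<in> coloured extended" and uv: "u @ v \<in> reduced_words" "length (u @ v) \<le> 2 * m"
    and z: "act (u @ v) y \<in> coloured extended"
  have l: "u \<in> lists Al" "v \<in> lists Al" using uv reduced_words_append_iff reduced_words_lists by blast+
  have X: "act v y \<in> X" "y \<in> X" using act_X l y Y_X by auto
  have zY: "act (u @ v) y \<in> Y" using act_Y uv y reduced_words_lists by blast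
  have ret: "act (winv u) (act (u @ v) y) = act v y"
    using act_winv[OF l(1) X(1)] by simp
  show "act v y \<in> coloured extended"
  proof (cases "y \<in> coloured A")
    case False
    then show ?thesis using convex_from_new y uv z by blast
  next
    case y_old: True
    show ?thesis
    proof (cases "act (u @ v) y \<in> coloured A")
      case True
      then show ?thesis
        using convex_A y y_old uv coloured_subset unfolding locally_convex_def by blast
    next
      case False
      have "act (winv v) (act (winv u) (act (u @ v) y)) = y"
        unfolding ret using act_winv[OF l(2) X(2)] .
      then have "act (winv v @ winv u) (act (u @ v) y) \<in> coloured extended"
        using y by simp
      moreover have "winv v @ winv u \<in> reduced_words" using winv_reduced_words[OF uv(1)] by simp
      ultimately have "act (winv u) (act (u @ v) y) \<in> coloured extended"
        using convex_from_new[of "act (u @ v) y" "winv v" "winv u"] zY z False uv(2) by simp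
      then show ?thesis using ret by simp
    qed
  qed
qed

lemma near_new:
  assumes "z \<in> Y" "near extended z" "\<not> near A z"
  obtains u w v where "u \<in> lists Al" "length u \<le> 2 * m" "w \<in> cluster" "v \<in> V" "v \<in> Y"
    "act u z = act w v"
proof -
  obtain u where u: "u \<in> reduced_words" "length u \<le> 2 * m" "act u z \<in> coloured extended"
    using assms by (auto simp: near_def)
  then have "act u z \<notin> coloured A" "act u z \<in> Y"
    using assms act_Y reduced_words_lists by (auto simp: near_def)
  then show ?thesis using new_point[of "act u z"] u that reduced_words_lists by metis
qed

text \<open>A path of length \<open>4 * n + 4 * m + 1\<close> begins and ends with stretches of length
\<open>n\<close>, each containing a point far from the old coloured points. If both were
near new points, these would belong to the same translate of the cluster, whose diameter is
too small to bridge the middle stretch.\<close>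

lemma extended_sparse: "sparse extended (4 * n + 4 * m + 1)"
  unfolding sparse_def
proof (intro ballI impI)
  fix y w assume y: "y \<in> Y" and w: "w \<in> reduced_words" "length w = 4 * n + 4 * m + 1"
  define a where "a = drop (3 * n + 4 * m + 1) w"
  define b where "b = drop n (take (3 * n + 4 * m + 1) w)"
  define c where "c = take n w"
  have len: "length a = n" "length b = 2 * n + 4 * m + 1" "length c = n"
    using w by (auto simp: a_def b_def c_def)
  have "take n (take (3 * n + 4 * m + 1) w) = c"
    by (simp add: c_def min_def)
  then have cba: "w = c @ b @ a"
    unfolding a_def b_def by (metis append_take_drop_id append.assoc)
  have reduced_words: "a \<in> reduced_words" "b \<in> reduced_words" "c \<in> reduced_words" "b @ a \<in> reduced_words"
    using w cba by (auto simp: reduced_words_append_iff)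
  obtain a1 a2 where a: "a = a1 @ a2" "\<not> near A (act a2 y)"
    using sparse_A y reduced_words len unfolding sparse_def by blast
  have "act (b @ a) y \<in> Y" using act_Y y reduced_words reduced_words_lists by blast
  then obtain c1 c2 where c: "c = c1 @ c2" "\<not> near A (act c2 (act (b @ a) y))"
    using sparse_A reduced_words len unfolding sparse_def by blast
  define d where "d = c2 @ b @ a1"
  define z where "z = act a2 y"
  have "c1 @ d @ a2 \<in> reduced_words" using w cba a c by (simp add: d_def)
  then have d: "d \<in> reduced_words" "a2 \<in> reduced_words" by (auto simp: reduced_words_append_iff)
  have zY: "z \<in> Y" "act d z \<in> Y" using act_Y y d reduced_words_lists by (auto simp: z_def)
  have dz: "act c2 (act (b @ a) y) = act d z" by (simp add: d_def z_def a)
  have dlen: "2 * n + 4 * m + 1 \<le> length d" "length d \<le> 4 * n + 4 * m + 1"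
    using len a c by (auto simp: d_def)
  have "\<not> (near extended z \<and> near extended (act d z))"
  proof
    assume ne: "near extended z \<and> near extended (act d z)"
    obtain u1 w1 v1 where 1: "u1 \<in> lists Al" "length u1 \<le> 2 * m" "w1 \<in> cluster" "v1 \<in> V" "v1 \<in> Y"
      "act u1 z = act w1 v1"
      using near_new zY ne a(2) z_def by metis
    obtain u2 w2 v2 where 2: "u2 \<in> lists Al" "length u2 \<le> 2 * m" "w2 \<in> cluster" "v2 \<in> V" "v2 \<in> Y"
      "act u2 (act d z) = act w2 v2"
      using near_new zY ne c(2) dz by metis
    have wl: "length w1 \<le> n" "length w2 \<le> n" "w1 \<in> lists Al" "w2 \<in> lists Al"
      using 1 2 cluster_length cluster_lists by auto
    have vX: "v1 \<in> X" "v2 \<in> X" "z \<in> X" "act d z \<in> X" using 1 2 zY Y_X by auto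
    have z1: "z = act (winv u1 @ w1) v1"
      using act_winv[of u1 z] 1 vX by simp
    have "v2 = act (winv w2 @ u2 @ d @ winv u1 @ w1) v1"
      using act_winv[of w2 v2] 2 wl vX z1 by simp
    then have "v1 = v2"
      using return_unique[of v1 "winv w2 @ u2 @ d @ winv u1 @ w1"] 1 2 wl dlen d(1) reduced_words_lists
        winv_lists by auto
    then have "act d z = act (winv u2 @ w2 @ winv w1 @ u1) z"
      using act_winv[of u2 "act d z"] act_winv[of w1 v1] 1 2 wl vX by simp
    moreover have "winv u2 @ w2 @ winv w1 @ u1 \<in> lists Al"
      using 1 2 wl winv_lists by auto
    ultimately have "length d \<le> length (winv u2 @ w2 @ winv w1 @ u1)"
      using reduced_word_shortest[OF d(1)] zY by blast
    then show False using 1 2 wl dlen by simp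
  qed
  moreover have "w = (c1 @ d) @ a2" "w = c1 @ (d @ a2)" using cba a c by (auto simp: d_def)
  moreover have "act (d @ a2) y = act d z" by (simp add: z_def)
  ultimately show "\<exists>u v. w = u @ v \<and> \<not> near extended (act v y)"
    unfolding z_def by metis
qed

lemma extended_admissible: "admissible extended"
  using extended_proper extended_convex extended_sparse by (auto simp: admissible_def)

lemma extended_x0: "x0 \<in> extended a0"
  unfolding extended_def using Nil_cluster x0_V by force

end

context edge_colouring
begin

text \<open>Each of these finitely many conditions either holds on some smaller nonempty open set or
fails everywhere on the given one.\<close>

lemma uniform_pattern:
  assumes A: "\<forall>k\<in>N. openin (top_of_set X) (A k)"
    and U: "openin (top_of_set X) U" "U \<noteq> {}"
  shows "\<exists>U'. openin (top_of_set X) U' \<and> U' \<noteq> {} \<and> U' \<subseteq> U \<and>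
    (\<forall>w\<in>reduced_words. \<forall>k\<in>N. length w \<le> R \<longrightarrow> (\<forall>y\<in>U'. act w y \<in> A k) \<or> (\<forall>y\<in>U'. act w y \<notin> A k))"
proof -
  have "\<exists>U'. openin (top_of_set X) U' \<and> U' \<noteq> {} \<and> U' \<subseteq> U \<and>
      (\<forall>(w, k)\<in>T. (\<forall>y\<in>U'. act w y \<in> A k) \<or> (\<forall>y\<in>U'. act w y \<notin> A k))"
    if "finite T" "T \<subseteq> reduced_words \<times> N" for T
    using that
  proof (induction T rule: finite_induct)
    case empty
    then show ?case using U by auto
  next
    case (insert t T)
    then obtain U' where U': "openin (top_of_set X) U'" "U' \<noteq> {}" "U' \<subseteq> U"
      "\<forall>(w, k)\<in>T. (\<forall>y\<in>U'. act w y \<in> A k) \<or> (\<forall>y\<in>U'. act w y \<notin> A k)"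
      by auto
    obtain w k where t: "t = (w, k)" "w \<in> reduced_words" "k \<in> N" using insert.prems by auto
    show ?case
    proof (cases "\<exists>y\<in>U'. act w y \<in> A k")
      case False
      then show ?thesis using U' t by (intro exI[of _ U']) auto
    next
      case True
      have wl: "w \<in> lists Al" using t reduced_words_lists by blast
      define U2 where "U2 = U' \<inter> act (winv w) ` A k"
      have "U' \<subseteq> X" "A k \<subseteq> X" using U'(1) A t openin_imp_subset by blast+
      then have "act w y \<in> A k" if "y \<in> U2" for y
        using that act_winv'[OF wl] by (auto simp: U2_def)
      moreover have "U2 \<noteq> {}"
      proof -
        obtain y where "y \<in> U'" "act w y \<in> A k" using True by auto
        moreover from this have "act (winv w) (act w y) = y"
          using act_winv wl \<open>U' \<subseteq> X\<close> by blast
        ultimately show ?thesis unfolding U2_def by force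
      qed
      moreover have "openin (top_of_set X) U2"
        unfolding U2_def using U'(1) A t openin_act_image winv_lists[OF wl] by blast
      ultimately show ?thesis using U' t
        by (intro exI[of _ U2]) (auto simp: U2_def)
    qed
  qed
  from this[of "{w \<in> reduced_words. length w \<le> R} \<times> N", OF finite_SigmaI[OF finite_short_reduced_words finite_N]]
  have "\<exists>U'. openin (top_of_set X) U' \<and> U' \<noteq> {} \<and> U' \<subseteq> U \<and>
      (\<forall>(w, k)\<in>{w \<in> reduced_words. length w \<le> R} \<times> N. (\<forall>y\<in>U'. act w y \<in> A k) \<or> (\<forall>y\<in>U'. act w y \<notin> A k))"
    by blast
  then show ?thesis by (rule ex_forward) blast
qed

lemma local_extension:
  assumes A: "proper_colouring A" "locally_convex A" "sparse A n"
    and U: "openin (top_of_set X) U" "x0 \<in> U" "x0 \<in> Y" "x0 \<notin> coloured A"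
    and pattern: "\<And>w k. w \<in> reduced_words \<Longrightarrow> length w \<le> n + 2 * m + 1 \<Longrightarrow> k \<in> N \<Longrightarrow>
      (\<forall>y\<in>U. act w y \<in> A k) \<or> (\<forall>y\<in>U. act w y \<notin> A k)"
    and a0: "a0 \<in> N" "compatible A x0 [] a0"
  shows "\<exists>A'. admissible A' \<and> (\<forall>k. A k \<subseteq> A' k) \<and> x0 \<in> A' a0"
proof -
  define F where "F = {w \<in> reduced_words. length w \<le> 6 * n + 8 * m + 1} - {[]}"
  \<comment> \<open>Half the least displacement of \<open>x0\<close> by a short word; as words act
      by isometries, no short word brings the ball back to itself.\<close>
  define \<delta> where "\<delta> = Min (insert 1 ((\<lambda>w. dist (act w x0) x0) ` F)) / 2"
  have finF: "finite F" using finite_short_reduced_words by (simp add: F_def)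
  have "dist (act w x0) x0 > 0" if "w \<in> F" for w
    using that free[OF U(3), of w] by (auto simp: F_def reduced_words_def)
  then have "\<delta> > 0" unfolding \<delta>_def using finF by auto
  have \<delta>: "2 * \<delta> \<le> dist (act w x0) x0" if "w \<in> F" for w
    unfolding \<delta>_def using finF that by simp
  define V where "V = U \<inter> ball x0 \<delta>"
  have "act w y \<notin> V" if w: "w \<in> F" and y: "y \<in> V" for w y
  proof
    assume wy: "act w y \<in> V"
    have "y \<in> X" "x0 \<in> X" using y U(1,3) Y_X openin_imp_subset unfolding V_def by blast+
    then have "dist (act w x0) (act w y) = dist x0 y"
      using act_dist w by (auto simp: F_def reduced_words_def)
    then have "dist (act w x0) x0 < 2 * \<delta>"
      using wy y dist_triangle[of "act w x0" x0 "act w y"] by (auto simp: V_def dist_commute)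
    then show False using \<delta>[OF w] by simp
  qed
  then have no_return: "act w y \<notin> V"
    if "y \<in> V" "w \<in> reduced_words" "w \<noteq> []" "length w \<le> 6 * n + 8 * m + 1" for y w
    using that by (simp add: F_def)
  have V_open: "openin (top_of_set X) V" unfolding V_def using U(1) openin_Int_open by blast
  have x0_V: "x0 \<in> V" using U \<open>\<delta> > 0\<close> by (auto simp: V_def)
  have same_pattern: "act w y \<in> A k \<longleftrightarrow> act w x0 \<in> A k"
    if "y \<in> V" "w \<in> reduced_words" "length w \<le> n + 2 * m + 1" "k \<in> N" for y w k
    using pattern[OF that(2-4)] that(1) U(2) by (auto simp: V_def)
  interpret extension_step X Y Al iv f N valid m A n x0 a0 V
    by (unfold_locales; fact)
  show ?thesis
    using extended_admissible extended_x0 by (intro exI[of _ extended]) (auto simp: extended_def)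
qed

lemma extension_meeting:
  assumes A: "admissible A" and U: "openin (top_of_set X) U" "U \<noteq> {}"
  shows "\<exists>A'. admissible A' \<and> (\<forall>k. A k \<subseteq> A' k) \<and> U \<inter> coloured A' \<noteq> {}"
proof -
  obtain n where A': "proper_colouring A" "locally_convex A" "sparse A n"
    using A by (auto simp: admissible_def)
  have "\<forall>k\<in>N. openin (top_of_set X) (A k)"
    using A' by (simp add: proper_colouring_def)
  from uniform_pattern[OF this U, of "n + 2 * m + 1"]
  obtain U' where U': "openin (top_of_set X) U'" "U' \<noteq> {}" "U' \<subseteq> U"
    and pattern: "\<forall>w\<in>reduced_words. \<forall>k\<in>N. length w \<le> n + 2 * m + 1 \<longrightarrow>
      (\<forall>y\<in>U'. act w y \<in> A k) \<or> (\<forall>y\<in>U'. act w y \<notin> A k)"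
    by (elim exE conjE) (rule that)
  obtain x0 where x0: "x0 \<in> U'" "x0 \<in> Y" using Y_dense U' by blast
  show ?thesis
  proof (cases "x0 \<in> coloured A")
    case True
    then show ?thesis using A x0 U' by blast
  next
    case False
    obtain a0 where a0: "a0 \<in> N" "compatible A x0 [] a0"
      using exists_compatible A' x0 by blast
    have "\<exists>A'. admissible A' \<and> (\<forall>k. A k \<subseteq> A' k) \<and> x0 \<in> A' a0"
      by (rule local_extension[OF A' U'(1) x0 False _ a0]) (rule pattern[rule_format])
    then obtain A2 where A2: "admissible A2" "\<forall>k. A k \<subseteq> A2 k" "x0 \<in> A2 a0"
      by (elim exE conjE) (rule that)
    moreover have "x0 \<in> U \<inter> coloured A2"
      using A2(3) a0(1) x0(1) U'(3) by (auto simp: coloured_def)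
    ultimately show ?thesis by (intro exI[of _ A2]) auto
  qed
qed

text \<open>At a point far from all coloured ones every colour is compatible. Sparseness provides such a
point on a sufficiently long path, and a uniform pattern makes a whole open set of them.\<close>

lemma extension_using:
  assumes A: "admissible A" and k: "k \<in> N"
  shows "\<exists>A'. admissible A' \<and> (\<forall>j. A j \<subseteq> A' j) \<and> A' k \<noteq> {}"
proof -
  obtain n where A': "proper_colouring A" "locally_convex A" "sparse A n"
    using A by (auto simp: admissible_def)
  have "\<forall>k\<in>N. openin (top_of_set X) (A k)"
    using A' by (simp add: proper_colouring_def)
  from uniform_pattern[OF this openin_subtopology_self X_nonempty, of "2 * n + 2 * m + 1"]
  obtain U where U: "openin (top_of_set X) U" "U \<noteq> {}"
    and pattern: "\<forall>w\<in>reduced_words. \<forall>k\<in>N. length w \<le> 2 * n + 2 * m + 1 \<longrightarrow>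
      (\<forall>y\<in>U. act w y \<in> A k) \<or> (\<forall>y\<in>U. act w y \<notin> A k)"
    by (elim exE conjE) (rule that)
  have UX: "U \<subseteq> X" using U(1) openin_imp_subset by blast
  obtain y where y: "y \<in> U" "y \<in> Y" using Y_dense U by blast
  obtain w where w: "w \<in> reduced_words" "length w = n" using long_words by (auto simp: reduced_words_def)
  obtain u v where uv: "w = u @ v" "\<not> near A (act v y)"
    using A'(3) w y unfolding sparse_def by blast
  have v: "v \<in> reduced_words" "v \<in> lists Al" "length v \<le> n"
    using w uv reduced_words_append_iff reduced_words_lists by auto
  define z where "z = act v y"
  have z: "z \<in> Y" "z \<in> act v ` U" "\<not> near A z"
    using y v act_Y uv by (auto simp: z_def)
  have not_hit: "act w z \<notin> coloured A" if "w \<in> reduced_words" "length w \<le> 2 * m" for w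
    using z that by (auto simp: near_def)
  have "(\<forall>x\<in>act v ` U. act w x \<in> A j) \<or> (\<forall>x\<in>act v ` U. act w x \<notin> A j)"
    if w: "w \<in> reduced_words" "length w \<le> n + 2 * m + 1" and j: "j \<in> N" for w j
  proof -
    have "w @ v \<in> lists Al" using w v reduced_words_lists by auto
    then obtain w' where "w' \<in> reduced_words" "length w' \<le> length (w @ v)" "\<forall>x\<in>X. act w' x = act (w @ v) x"
      using exists_reduced_word by blast
    moreover from this have "length w' \<le> 2 * n + 2 * m + 1" using w v by simp
    ultimately have "(\<forall>x\<in>U. act w' x \<in> A j) \<or> (\<forall>x\<in>U. act w' x \<notin> A j)"
      using pattern j by blast
    moreover have "act w (act v x) = act w' x" if "x \<in> U" for x
      using \<open>\<forall>x\<in>X. act w' x = act (w @ v) x\<close> UX that by auto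
    ultimately show ?thesis by simp
  qed
  moreover have "z \<notin> coloured A" using not_hit[of "[]"] by simp
  moreover have "compatible A z [] k"
    using not_hit by (auto simp: compatible_def first_hit_def)
  ultimately have "\<exists>A'. admissible A' \<and> (\<forall>j. A j \<subseteq> A' j) \<and> z \<in> A' k"
    by (intro local_extension[OF A' openin_act_image[OF v(2) U(1)] z(2,1) _ _ k])
  then show ?thesis by (elim exE conjE) auto
qed

lemma empty_admissible: "admissible (\<lambda>_. {})"
proof -
  have "sparse (\<lambda>_. {}) 0" by (auto simp: sparse_def near_def coloured_def)
  then show ?thesis
    by (auto simp: admissible_def proper_colouring_def locally_convex_def coloured_def)
qed

theorem exists_dense_colouring:
  "\<exists>A. (\<forall>k\<in>N. openin (top_of_set X) (A k) \<and> A k \<noteq> {}) \<and>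
    (\<forall>y\<in>Y. \<forall>j\<in>N. \<forall>k\<in>N. y \<in> A j \<longrightarrow> y \<in> A k \<longrightarrow> j = k) \<and>
    (\<forall>y\<in>Y. \<forall>s\<in>Al. \<forall>j\<in>N. \<forall>k\<in>N. y \<in> A j \<longrightarrow> f s y \<in> A k \<longrightarrow> valid s j k) \<and>
    (\<forall>U. openin (top_of_set X) U \<longrightarrow> U \<noteq> {} \<longrightarrow> U \<inter> (\<Union>k\<in>N. A k) \<noteq> {})"
proof -
  have start: "\<exists>A. admissible A \<and> (\<forall>k\<in>F. A k \<noteq> {})" if "finite F" "F \<subseteq> N" for F
    using that
  proof (induction F rule: finite_induct)
    case empty
    then show ?case using empty_admissible by auto
  next
    case (insert k F)
    then have "\<exists>A. admissible A \<and> (\<forall>k\<in>F. A k \<noteq> {})" by simp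
    then obtain A where A: "admissible A" "\<forall>k\<in>F. A k \<noteq> {}"
      by (elim exE conjE) (rule that)
    have "k \<in> N" using insert.prems by simp
    from extension_using[OF A(1) this]
    obtain A' where A': "admissible A'" "\<forall>j. A j \<subseteq> A' j" "A' k \<noteq> {}"
      by (elim exE conjE) (rule that)
    have "A' j \<noteq> {}" if "j \<in> F" for j
      using A(2) A'(2) that by (metis subset_empty)
    then show ?case using A' by (intro exI[of _ A']) simp
  qed
  obtain \<B> :: "'a set set" where B: "countable \<B>" "topological_basis \<B>"
    using ex_countable_basis by blast
  \<comment> \<open>Step \<open>n\<close> makes the colouring meet the basic open set \<open>U
      n\<close>.\<close>
  define U where "U n = X \<inter> from_nat_into \<B> n" for n
  define P where "P A \<longleftrightarrow> admissible A \<and> (\<forall>k\<in>N. A k \<noteq> {})" for A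
  have "\<B> \<noteq> {}" using topological_basisE[OF B(2) open_UNIV UNIV_I] by blast
  have U_open: "openin (top_of_set X) (U n)" for n
    unfolding U_def using B(2) from_nat_into[OF \<open>\<B> \<noteq> {}\<close>] topological_basis_open by blast
  have "\<exists>A'. P A' \<and> ((\<forall>k. A k \<subseteq> A' k) \<and> (U n \<noteq> {} \<longrightarrow> U n \<inter> coloured A' \<noteq> {}))"
    if "P A" for A n
  proof (cases "U n = {}")
    case True
    then show ?thesis using that by auto
  next
    case False
    have "admissible A" using that by (simp add: P_def)
    from extension_meeting[OF this U_open False]
    obtain A' where A': "admissible A'" "\<forall>k. A k \<subseteq> A' k" "U n \<inter> coloured A' \<noteq> {}"
      by (elim exE conjE) (rule that)
    have "P A'"
      unfolding P_def
    proof (intro conjI ballI)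
      fix k assume "k \<in> N"
      then have "A k \<noteq> {}" using that by (simp add: P_def)
      then show "A' k \<noteq> {}" using A'(2) by auto
    qed (rule A'(1))
    then show ?thesis using A' by (intro exI[of _ A']) simp
  qed
  moreover have "\<exists>A. P A" using start[OF finite_N] by (simp add: P_def)
  ultimately have "\<exists>A. \<forall>n. P (A n) \<and>
      ((\<forall>k. A n k \<subseteq> A (Suc n) k) \<and> (U n \<noteq> {} \<longrightarrow> U n \<inter> coloured (A (Suc n)) \<noteq> {}))"
    by (intro dependent_nat_choice)
  then obtain A where A: "\<forall>n. P (A n) \<and>
      ((\<forall>k. A n k \<subseteq> A (Suc n) k) \<and> (U n \<noteq> {} \<longrightarrow> U n \<inter> coloured (A (Suc n)) \<noteq> {}))"
    by (elim exE) (rule that)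
  have mono: "A n k \<subseteq> A n' k" if "n \<le> n'" for n n' k
    using lift_Suc_mono_le[of "\<lambda>n. A n k"] A that by simp
  have proper: "proper_colouring (A n)" for n using A by (simp add: P_def admissible_def)
  define C where "C k = (\<Union>n. A n k)" for k
  have common: "\<exists>n. y \<in> A n j \<and> z \<in> A n k" if yz: "y \<in> C j" "z \<in> C k" for y z j k
  proof -
    obtain a b where "y \<in> A a j" "z \<in> A b k" using yz by (auto simp: C_def)
    then show ?thesis using mono[of a "max a b" j] mono[of b "max a b" k]
      by (intro exI[of _ "max a b"]) auto
  qed
  show ?thesis
  proof (intro exI[of _ C] conjI ballI allI impI)
    show "openin (top_of_set X) (C k)" if "k \<in> N" for k
      unfolding C_def using proper that by (auto simp: proper_colouring_def)
    show "C k \<noteq> {}" if "k \<in> N" for k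
    proof -
      have "A 0 k \<noteq> {}" using A that by (simp add: P_def)
      then show ?thesis by (auto simp: C_def)
    qed
    show "j = k" if "y \<in> Y" "j \<in> N" "k \<in> N" "y \<in> C j" "y \<in> C k" for y j k
      using common[OF that(4,5)] proper that(1-3) unfolding proper_colouring_def by blast
    show "valid s j k" if "y \<in> Y" "s \<in> Al" "j \<in> N" "k \<in> N" "y \<in> C j" "f s y \<in> C k" for y s j k
      using common[OF that(5,6)] proper that(1-4) unfolding proper_colouring_def by blast
    show "W \<inter> (\<Union>k\<in>N. C k) \<noteq> {}" if W: "openin (top_of_set X) W" "W \<noteq> {}" for W
    proof -
      obtain T where T: "open T" "W = X \<inter> T" using W(1) openin_open by blast
      obtain x where x: "x \<in> X" "x \<in> T" using W T by auto
      obtain B' where B': "B' \<in> \<B>" "x \<in> B'" "B' \<subseteq> T"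
        using topological_basisE[OF B(2) T(1) x(2)] by blast
      obtain n where n: "B' = from_nat_into \<B> n"
        using from_nat_into_surj[OF B(1) B'(1)] by metis
      then have "U n \<inter> coloured (A (Suc n)) \<noteq> {}"
        using A x B' by (auto simp: U_def)
      then show ?thesis using n B' T unfolding U_def coloured_def C_def by blast
    qed
  qed
qed

end

section \<open>Reflections without relations\<close>

definition reflection :: "real ^ 3 \<Rightarrow> real ^ 3 \<Rightarrow> real ^ 3" where
  "reflection u x = x - (2 * (u \<bullet> x) / (u \<bullet> u)) *\<^sub>R u"

lemma linear_reflection: "linear (reflection u)"
  by (rule linearI) (auto simp: reflection_def inner_add_right algebra_simps add_divide_distrib)

lemma reflection_reflection: "reflection u (reflection u x) = x"
  by (cases "u = 0") (simp_all add: reflection_def inner_diff_right algebra_simps)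

lemma norm_reflection: "norm (reflection u x) = norm x"
proof -
  have "reflection u x \<bullet> reflection u x = x \<bullet> x"
    by (cases "u = 0")
      (simp_all add: reflection_def inner_diff_right inner_diff_left inner_commute field_simps)
  then show ?thesis by (simp add: norm_eq_sqrt_inner)
qed

definition integral_vectors :: "(real ^ 3) set" where
  "integral_vectors = {x. \<forall>i. x $ i \<in> \<int>}"

lemma integral_vectors_intros:
  "0 \<in> integral_vectors"
  "x \<in> integral_vectors \<Longrightarrow> y \<in> integral_vectors \<Longrightarrow> x + y \<in> integral_vectors"
  "x \<in> integral_vectors \<Longrightarrow> y \<in> integral_vectors \<Longrightarrow> x - y \<in> integral_vectors"
  "a \<in> \<int> \<Longrightarrow> x \<in> integral_vectors \<Longrightarrow> a *\<^sub>R x \<in> integral_vectors"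
  by (auto simp: integral_vectors_def)

lemma inner_integral: "x \<in> integral_vectors \<Longrightarrow> y \<in> integral_vectors \<Longrightarrow> x \<bullet> y \<in> \<int>"
  by (auto simp: integral_vectors_def inner_vec_def intro!: Ints_sum)

text \<open>Every prime factor of \<open>(n + 2)! ^ 2 + 1\<close> exceeds \<open>n + 2\<close>.\<close>

lemma prime_with_root_of_minus_one:
  "\<exists>p a::int. prime p \<and> int n < p \<and> p dvd a\<^sup>2 + 1 \<and> odd p"
proof -
  define a :: int where "a = fact (n + 2)"
  have "a \<ge> 1" unfolding a_def by (rule fact_ge_1)
  then have "\<bar>a\<^sup>2 + 1\<bar> \<noteq> 1" by (simp add: add_nonneg_eq_0_iff)
  moreover have "a\<^sup>2 + 1 \<noteq> 0" by (simp add: add_nonneg_eq_0_iff)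
  ultimately obtain p where p: "prime p" "p dvd a\<^sup>2 + 1"
    using prime_divisor_exists[of "a\<^sup>2 + 1"] by (auto simp: zdvd1_eq)
  have *: "int (n + 2) < p"
  proof (rule ccontr)
    assume "\<not> int (n + 2) < p"
    then have "nat p \<le> n + 2" "nat p \<ge> 1" using prime_gt_0_int[OF p(1)] by auto
    then have "(of_nat (nat p) :: int) dvd fact (n + 2)" using dvd_fact[of "nat p" "n + 2"]
      by (metis of_nat_dvd_iff of_nat_fact)
    then have "p dvd a" using prime_gt_0_int[OF p(1)] by (simp add: a_def)
    then have "p dvd a\<^sup>2" by (simp add: power2_eq_square)
    then have "p dvd 1" using p(2) dvd_add_right_iff by blast
    then show False using p(1) not_prime_unit by blast
  qed
  then have "odd p" using p(1) primes_dvd_imp_eq[of 2 p] by auto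
  then show ?thesis using p * by (intro exI[of _ p] exI[of _ a]) auto
qed

text \<open>If \<open>a\<close> is a square root of \<open>-1\<close> modulo \<open>p\<close>, this is
the usual parametrisation of the conic \<open>x^2 + y^2 + z^2 = 0\<close> modulo
\<open>p\<close>.\<close>

definition isotropic :: "int \<Rightarrow> nat \<Rightarrow> real ^ 3" where
  "isotropic a i = vector [1 - (real i)\<^sup>2, 2 * real i, of_int a * (1 + (real i)\<^sup>2)]"

lemma isotropic_integral: "isotropic a i \<in> integral_vectors"
  by (auto simp: integral_vectors_def isotropic_def forall_3)

lemma inner_isotropic:
  "isotropic a i \<bullet> isotropic a j =
     of_int ((a\<^sup>2 + 1) * (1 + (int i)\<^sup>2) * (1 + (int j)\<^sup>2) - 2 * (int i - int j)\<^sup>2)"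
  by (simp add: isotropic_def inner_vec_def sum_3 power2_eq_square algebra_simps)

text \<open>\<open>x\<close> is congruent modulo \<open>p\<close> to a multiple of \<open>u\<close> by
an integer prime to \<open>p\<close>.\<close>

definition multiple_mod :: "int \<Rightarrow> real ^ 3 \<Rightarrow> real ^ 3 \<Rightarrow> bool" where
  "multiple_mod p u x \<longleftrightarrow> (\<exists>c. \<exists>e\<in>integral_vectors. \<not> p dvd c \<and> x = of_int c *\<^sub>R u + of_int p *\<^sub>R e)"

text \<open>Multiplied by \<open>u \<bullet> u\<close>, which vanishes modulo \<open>p\<close>, the
reflection becomes \<open>x \<mapsto> - 2 (u \<bullet> x) u\<close>.\<close>

lemma reflection_multiple_mod:
  assumes u: "u \<in> integral_vectors" and v: "v \<in> integral_vectors"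
    and uu: "u \<bullet> u = of_int s" "p dvd s" "s \<noteq> 0" and uv: "u \<bullet> v = of_int g" "\<not> p dvd g"
    and p: "prime p" "odd p"
    and x: "multiple_mod p v x"
  shows "multiple_mod p u (of_int s *\<^sub>R reflection u x)"
proof -
  obtain c e where ce: "e \<in> integral_vectors" "\<not> p dvd c" "x = of_int c *\<^sub>R v + of_int p *\<^sub>R e"
    using x by (auto simp: multiple_mod_def)
  obtain s' where s': "s = p * s'" using uu(2) by auto
  have "\<not> p dvd 2" using p primes_dvd_imp_eq[of p 2] by auto
  then have c': "\<not> p dvd - 2 * c * g"
    using ce(2) uv(2) p(1) prime_dvd_mult_iff[of p] by simp
  have "x \<in> integral_vectors" unfolding ce(3) using v ce(1) by (intro integral_vectors_intros) auto
  then have e': "of_int s' *\<^sub>R x - (2 * (u \<bullet> e)) *\<^sub>R u \<in> integral_vectors"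
    using u ce(1) by (intro integral_vectors_intros Ints_mult inner_integral) auto
  have "of_int s *\<^sub>R reflection u x = of_int s *\<^sub>R x - (2 * (u \<bullet> x)) *\<^sub>R u"
    using uu by (simp add: reflection_def algebra_simps)
  also have "u \<bullet> x = of_int c * of_int g + of_int p * (u \<bullet> e)"
    by (simp add: ce(3) inner_add_right uv)
  also have "of_int s *\<^sub>R x - (2 * (of_int c * of_int g + of_int p * (u \<bullet> e))) *\<^sub>R u =
      of_int (- 2 * c * g) *\<^sub>R u + of_int p *\<^sub>R (of_int s' *\<^sub>R x - (2 * (u \<bullet> e)) *\<^sub>R u)"
    by (simp add: s' algebra_simps)
  finally show ?thesis using c' e' unfolding multiple_mod_def by blast
qed

text \<open>The word is applied to one further isotropic vector \<open>u n\<close>. If the word acted as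
the identity, the vector with denominators cleared would vanish modulo \<open>p\<close>, but
it is a nonzero multiple of the first vector of the word.\<close>

theorem exists_free_reflections:
  "\<exists>u :: nat \<Rightarrow> real ^ 3. \<forall>w. w \<noteq> [] \<longrightarrow> set w \<subseteq> {..<n} \<longrightarrow> distinct_adj w \<longrightarrow>
     (\<exists>x. foldr (\<lambda>i. reflection (u i)) w x \<noteq> x)"
proof -
  obtain p a :: int where p: "prime p" "int n < p" "p dvd a\<^sup>2 + 1" "odd p"
    using prime_with_root_of_minus_one by blast
  define u where "u = isotropic a"
  define act where "act = foldr (\<lambda>i. reflection (u i))"
  have a0: "a\<^sup>2 + 1 \<noteq> 0" by (simp add: add_nonneg_eq_0_iff)
  have step: "multiple_mod p (u i) (of_int ((a\<^sup>2 + 1) * (1 + (int i)\<^sup>2)\<^sup>2) *\<^sub>R reflection (u i) x)"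
    if ij: "i \<le> n" "j \<le> n" "i \<noteq> j" and x: "multiple_mod p (u j) x" for i j x
  proof (rule reflection_multiple_mod[OF _ _ _ _ _ inner_isotropic[of a i j, folded u_def] _ p(1,4) x])
    show "u i \<in> integral_vectors" "u j \<in> integral_vectors"
      by (simp_all add: u_def isotropic_integral)
    show "u i \<bullet> u i = of_int ((a\<^sup>2 + 1) * (1 + (int i)\<^sup>2)\<^sup>2)"
      unfolding u_def inner_isotropic by (simp add: power2_eq_square)
    show "p dvd (a\<^sup>2 + 1) * (1 + (int i)\<^sup>2)\<^sup>2" using p(3) by simp
    have "(1 + (int i)\<^sup>2) \<noteq> 0" by (simp add: add_nonneg_eq_0_iff)
    then show "(a\<^sup>2 + 1) * (1 + (int i)\<^sup>2)\<^sup>2 \<noteq> 0" using a0 by simp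
    show "\<not> p dvd (a\<^sup>2 + 1) * (1 + (int i)\<^sup>2) * (1 + (int j)\<^sup>2) - 2 * (int i - int j)\<^sup>2"
    proof
      assume "p dvd (a\<^sup>2 + 1) * (1 + (int i)\<^sup>2) * (1 + (int j)\<^sup>2) - 2 * (int i - int j)\<^sup>2"
      moreover have "p dvd (a\<^sup>2 + 1) * (1 + (int i)\<^sup>2) * (1 + (int j)\<^sup>2)" using p(3) by simp
      ultimately have "p dvd 2 * (int i - int j)\<^sup>2"
        by (metis dvd_diffD dvd_diff diff_diff_eq2 add_diff_cancel_left')
      moreover have "\<not> p dvd 2" using p primes_dvd_imp_eq[of p 2] by auto
      ultimately have "p dvd int i - int j"
        using p(1) prime_dvd_mult_iff[of p] by (metis prime_dvd_power_iff pos2)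
      then have "p \<le> \<bar>int i - int j\<bar>"
        using ij(3) dvd_imp_le_int[of "int i - int j" p] p by auto
      then show False using ij p(2) by auto
    qed
  qed
  have word: "\<exists>s::int. multiple_mod p (u (hd (w @ [n]))) (of_int s *\<^sub>R act w (u n)) \<and>
      (w \<noteq> [] \<longrightarrow> p dvd s)" if "set w \<subseteq> {..<n}" "distinct_adj w" for w
    using that
  proof (induction w)
    case Nil
    have "\<not> p dvd 1" using p(1) not_prime_unit by blast
    then have "multiple_mod p (u n) (of_int 1 *\<^sub>R act [] (u n))"
      unfolding multiple_mod_def act_def
      by (intro exI[of _ 1] bexI[of _ 0]) (auto simp: integral_vectors_intros)
    then show ?case by (intro exI[of _ 1]) simp
  next
    case (Cons i w)
    then obtain s :: int where s: "multiple_mod p (u (hd (w @ [n]))) (of_int s *\<^sub>R act w (u n))"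
      by (auto simp: distinct_adj_Cons)
    have hd: "i \<noteq> hd (w @ [n])" "i \<le> n" "hd (w @ [n]) \<le> n"
      using Cons.prems by (cases w; auto simp: distinct_adj_Cons)+
    define t where "t = (a\<^sup>2 + 1) * (1 + (int i)\<^sup>2)\<^sup>2"
    have "of_int t *\<^sub>R reflection (u i) (of_int s *\<^sub>R act w (u n)) =
        of_int (t * s) *\<^sub>R act (i # w) (u n)"
      by (simp add: linear_cmul[OF linear_reflection] act_def)
    moreover have "p dvd t * s" using p(3) by (simp add: t_def)
    ultimately show ?case
      using step[OF hd(2,3,1) s, folded t_def] by (intro exI[of _ "t * s"]) simp
  qed
  have "act w (u n) \<noteq> u n" if w: "w \<noteq> []" "set w \<subseteq> {..<n}" "distinct_adj w" for w
  proof
    assume fixed: "act w (u n) = u n"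
    define i where "i = hd w"
    obtain s :: int where s: "multiple_mod p (u i) (of_int s *\<^sub>R act w (u n))" "p dvd s"
      using word[OF w(2,3)] w(1) by (auto simp: i_def)
    obtain c e where ce: "e \<in> integral_vectors" "\<not> p dvd c"
      "of_int s *\<^sub>R u n = of_int c *\<^sub>R u i + of_int p *\<^sub>R e"
      using s(1) fixed by (auto simp: multiple_mod_def)
    obtain s' where s': "s = p * s'" using s(2) by auto
    define d where "d = of_int s' *\<^sub>R u n - e"
    have d: "d \<in> integral_vectors"
      unfolding d_def u_def by (intro integral_vectors_intros isotropic_integral ce) auto
    have eq: "of_int c *\<^sub>R u i = of_int p *\<^sub>R d"
      using ce(3) by (simp add: d_def s' algebra_simps)
    have dvd: "p dvd z" if z: "u i $ k = of_int z" for z k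
    proof -
      obtain y where y: "d $ k = of_int y" using d by (auto simp: integral_vectors_def elim: Ints_cases)
      have "of_int c * (of_int z :: real) = of_int p * of_int y"
        using arg_cong[OF eq, of "\<lambda>x. x $ k"] z y by simp
      then have "c * z = p * y" by (simp only: of_int_mult[symmetric] of_int_eq_iff)
      then have "p dvd c * z" by simp
      then show ?thesis using p(1) ce(2) prime_dvd_mult_iff by blast
    qed
    have 1: "p dvd 1 - (int i)\<^sup>2"
      by (rule dvd[of 1]) (simp add: u_def isotropic_def)
    have 2: "p dvd 2 * int i"
      by (rule dvd[of 2]) (simp add: u_def isotropic_def)
    have "\<not> p dvd 2" using p primes_dvd_imp_eq[of p 2] by auto
    then have "p dvd int i" using 2 p(1) prime_dvd_mult_iff by blast
    then have "p dvd (int i)\<^sup>2" by (simp add: power2_eq_square)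
    then have "p dvd 1" using 1 by (metis dvd_add diff_add_cancel)
    then show False using p(1) not_prime_unit by blast
  qed
  then show ?thesis unfolding act_def by blast
qed

section \<open>From deducible subcongruences to independent letters\<close>

text \<open>\<open>Fwd p\<close> leads from the root of the class of \<open>p\<close> to
\<open>p\<close>, with inverse \<open>Bwd p\<close>; \<open>Flip q\<close> exchanges a root
\<open>q\<close> with its complement.\<close>

datatype 'c letter = Fwd "'c set" | Bwd "'c set" | Flip "'c set"

fun letter_inv :: "'c letter \<Rightarrow> 'c letter" where
  "letter_inv (Fwd p) = Bwd p"
| "letter_inv (Bwd p) = Fwd p"
| "letter_inv (Flip p) = Flip p"

lemma letter_inv_inv: "letter_inv (letter_inv s) = s"
  by (cases s) auto

text \<open>The properties of deducibility that the proof relies on. The index \<open>c0\<close> serves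
to select one set from every complementary pair.\<close>

locale subcongruence_order =
  fixes N :: "'c set" and le :: "'c set \<Rightarrow> 'c set \<Rightarrow> bool" and c0 :: 'c
  assumes finite_N: "finite N" and c0_N: "c0 \<in> N"
    and le_subset: "A \<subseteq> B \<Longrightarrow> B \<subseteq> N \<Longrightarrow> le A B"
    and le_trans: "le A B \<Longrightarrow> le B C \<Longrightarrow> le A C"
    and le_compl: "le A B \<Longrightarrow> le (N - B) (N - A)"
    and le_consistent: "A \<subseteq> N \<Longrightarrow> le A B \<Longrightarrow> B \<subseteq> A \<Longrightarrow> A = B"
begin

definition eqv :: "'c set \<Rightarrow> 'c set \<Rightarrow> bool" where
  "eqv A B \<longleftrightarrow> A \<subseteq> N \<and> B \<subseteq> N \<and> le A B \<and> le B A"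

lemma eqv_refl: "A \<subseteq> N \<Longrightarrow> eqv A A"
  by (simp add: eqv_def le_subset)

lemma eqv_sym: "eqv A B \<Longrightarrow> eqv B A"
  by (simp add: eqv_def)

lemma eqv_trans: "eqv A B \<Longrightarrow> eqv B C \<Longrightarrow> eqv A C"
  unfolding eqv_def using le_trans by blast

lemma eqv_compl: "eqv A B \<Longrightarrow> eqv (N - A) (N - B)"
  unfolding eqv_def using le_compl by blast

definition oriented :: "'c set set" where
  "oriented = {p. p \<subset> N \<and> c0 \<in> p}"

definition orient :: "'c set \<Rightarrow> 'c set" where
  "orient A = (if c0 \<in> A then A else N - A)"

text \<open>The description depends only on the class of the pair of \<open>p\<close> and its
complement, so all members share their root.\<close>

definition root :: "'c set \<Rightarrow> 'c set" where
  "root p = (SOME q. q \<in> oriented \<and> (eqv q p \<or> eqv q (N - p)))"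

text \<open>The one of the root and its complement that is equivalent to \<open>p\<close>. The value at
the empty set makes \<open>Fwd {}\<close> a letter that imposes no condition.\<close>

definition base :: "'c set \<Rightarrow> 'c set" where
  "base p = (if p = {} then {} else if eqv (root p) p then root p else N - root p)"

lemma oriented_subset: "p \<in> oriented \<Longrightarrow> p \<subseteq> N"
  by (auto simp: oriented_def)

lemma root_props:
  assumes "p \<in> oriented"
  shows "root p \<in> oriented" "eqv (root p) p \<or> eqv (root p) (N - p)"
proof -
  have "\<exists>q. q \<in> oriented \<and> (eqv q p \<or> eqv q (N - p))"
    using assms eqv_refl oriented_subset by blast
  then have "root p \<in> oriented \<and> (eqv (root p) p \<or> eqv (root p) (N - p))"
    unfolding root_def by (rule someI_ex)
  then show "root p \<in> oriented" "eqv (root p) p \<or> eqv (root p) (N - p)" by auto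
qed

lemma eqv_cong: "eqv a b \<Longrightarrow> eqv x a \<longleftrightarrow> eqv x b"
  using eqv_trans eqv_sym by blast

lemma root_cong:
  assumes pq: "eqv p q \<or> eqv p (N - q)" and q: "q \<subseteq> N"
  shows "root p = root q"
proof -
  have "eqv x p \<or> eqv x (N - p) \<longleftrightarrow> eqv x q \<or> eqv x (N - q)" for x
    using pq
  proof
    assume "eqv p q"
    then show ?thesis using eqv_cong eqv_compl by blast
  next
    assume e: "eqv p (N - q)"
    then have "eqv (N - p) q" using eqv_compl[OF e] q by (simp add: double_diff)
    then show ?thesis using e eqv_cong by blast
  qed
  then show ?thesis by (simp add: root_def)
qed

lemma root_root: "p \<in> oriented \<Longrightarrow> root (root p) = root p"
  using root_props root_cong oriented_subset by blast

lemma base_eqv: "p \<in> oriented \<Longrightarrow> eqv (base p) p"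
proof -
  assume p: "p \<in> oriented"
  then have "p \<noteq> {}" by (auto simp: oriented_def)
  moreover have "eqv (N - root p) p" if "eqv (root p) (N - p)"
    using eqv_compl[OF that] oriented_subset[OF p] by (simp add: double_diff)
  ultimately show ?thesis using root_props[OF p] by (auto simp: base_def)
qed

fun src :: "'c letter \<Rightarrow> 'c set" where
  "src (Fwd p) = base p"
| "src (Bwd p) = p"
| "src (Flip q) = q"

fun tgt :: "'c letter \<Rightarrow> 'c set" where
  "tgt (Fwd p) = p"
| "tgt (Bwd p) = base p"
| "tgt (Flip q) = N - q"

text \<open>The letter \<open>Fwd {}\<close> ensures that there are reduced words of every length even
if there are no congruences.\<close>

definition letters :: "'c letter set" where
  "letters = {s. \<exists>p. (s = Fwd p \<or> s = Bwd p) \<and> (p = {} \<or> p \<in> oriented \<and> root p \<noteq> p)} \<union>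
     {s. \<exists>q. s = Flip q \<and> q \<in> oriented \<and> root q = q \<and> eqv q (N - q)}"

definition valid :: "'c letter \<Rightarrow> 'c \<Rightarrow> 'c \<Rightarrow> bool" where
  "valid s a b \<longleftrightarrow> (a \<in> src s \<longleftrightarrow> b \<in> tgt s)"

lemma finite_letters: "finite letters"
proof (rule finite_subset)
  show "letters \<subseteq> Fwd ` Pow N \<union> Bwd ` Pow N \<union> Flip ` Pow N"
    using oriented_subset by (auto simp: letters_def)
qed (simp add: finite_N)

lemma letter_inv_letters: "s \<in> letters \<Longrightarrow> letter_inv s \<in> letters"
  by (auto simp: letters_def)

lemma src_tgt_eqv: "s \<in> letters \<Longrightarrow> eqv (src s) (tgt s)"
proof -
  assume s: "s \<in> letters"
  have "eqv (base p) p" if "p = {} \<or> p \<in> oriented" for p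
    using base_eqv[of p] eqv_refl[of "{}"] that by (auto simp: base_def[of "{}"])
  then show ?thesis using s eqv_sym unfolding letters_def by fastforce
qed

lemma src_tgt_proper:
  "s \<in> letters \<Longrightarrow> src s = {} \<and> tgt s = {} \<or>
     src s \<noteq> {} \<and> src s \<subset> N \<and> tgt s \<noteq> {} \<and> tgt s \<subset> N"
proof -
  assume s: "s \<in> letters"
  have o: "q \<noteq> {}" "q \<subset> N" "N - q \<noteq> {}" "N - q \<subset> N" if "q \<in> oriented" for q
    using that c0_N by (auto simp: oriented_def)
  have b: "base q \<noteq> {}" "base q \<subset> N" if "q \<in> oriented" for q
    using o[OF that] o[OF root_props(1)[OF that]] by (simp_all add: base_def)
  from s consider p where "s = Fwd p \<or> s = Bwd p" "p = {}"
    | p where "s = Fwd p \<or> s = Bwd p" "p \<in> oriented" | q where "s = Flip q" "q \<in> oriented"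
    unfolding letters_def by blast
  then show ?thesis
  proof cases
    case 1
    then show ?thesis by (auto simp: base_def)
  next
    case 2
    then show ?thesis using o(1,2)[OF 2(2)] b[OF 2(2)] by (elim disjE) simp_all
  next
    case 3
    then show ?thesis using o[OF 3(2)] by simp
  qed
qed

lemma valid_letter_inv:
  "s \<in> letters \<Longrightarrow> a \<in> N \<Longrightarrow> b \<in> N \<Longrightarrow> valid (letter_inv s) b a \<longleftrightarrow> valid s a b"
  by (auto simp: letters_def valid_def)

lemma valid_total: "s \<in> letters \<Longrightarrow> a \<in> N \<Longrightarrow> \<exists>b\<in>N. valid s a b"
  using src_tgt_proper[of s] unfolding valid_def by blast

definition reach :: "'c letter list \<Rightarrow> 'c \<Rightarrow> 'c set" where
  "reach w a = {c \<in> N. linked N valid w a c}"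

lemma reach_subset: "reach w a \<subseteq> N"
  by (auto simp: reach_def)

lemma reach_Cons: "reach (s # w) a = {c \<in> N. \<exists>b\<in>reach w a. valid s b c}"
  by (auto simp: reach_def)

lemma reach_nonempty: "w \<in> lists letters \<Longrightarrow> a \<in> N \<Longrightarrow> reach w a \<noteq> {}"
proof (induction w)
  case Nil
  then show ?case by (auto simp: reach_def)
next
  case (Cons s w)
  then obtain b where "b \<in> reach w a" by auto
  moreover from this have "b \<in> N" using reach_subset by blast
  ultimately show ?case using valid_total[of s b] Cons by (auto simp: reach_Cons)
qed

text \<open>If the possible colours meet both the source and its complement, every colour is possible
after the next edge.\<close>

lemma reach_step:
  assumes w: "s # w \<in> lists letters" and a: "a \<in> N" and ne: "reach (s # w) a \<noteq> N"
  shows "reach w a \<subseteq> src s \<and> reach (s # w) a = tgt s \<or>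
    reach w a \<subseteq> N - src s \<and> reach (s # w) a = N - tgt s"
proof -
  have tgt: "tgt s \<subseteq> N" using src_tgt_proper[of s] w by auto
  obtain b where b: "b \<in> reach w a" using reach_nonempty[of w a] w a by auto
  consider "reach w a \<subseteq> src s" | "reach w a \<subseteq> N - src s"
    using ne reach_subset[of w a] unfolding reach_Cons valid_def by blast
  then show ?thesis
    using b tgt by cases (auto simp: reach_Cons valid_def)
qed

lemma reach_step_proper:
  assumes w: "s # w \<in> lists letters" and a: "a \<in> N" and ne: "reach (s # w) a \<noteq> N"
  shows "src s \<noteq> {}" "reach w a \<noteq> N" "le (reach w a) (reach (s # w) a)"
proof -
  have s: "s \<in> letters" using w by simp
  have st: "eqv (src s) (tgt s)" "eqv (N - src s) (N - tgt s)"
    using src_tgt_eqv[OF s] eqv_compl by auto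
  have wa: "reach w a \<noteq> {}" using reach_nonempty w a by auto
  note step = reach_step[OF assms]
  show "src s \<noteq> {}" using src_tgt_proper[OF s] step ne wa by auto
  then show "reach w a \<noteq> N" using src_tgt_proper[OF s] step by auto
  show "le (reach w a) (reach (s # w) a)"
    using step st le_subset le_trans unfolding eqv_def by metis
qed

lemma orient_compl: "A \<subseteq> N \<Longrightarrow> orient (N - A) = orient A"
  using c0_N by (auto simp: orient_def)

lemma orient_oriented: "p \<in> oriented \<Longrightarrow> orient p = p"
  by (simp add: orient_def oriented_def)

lemma orient_base: "p \<in> oriented \<Longrightarrow> orient (base p) = root p"
  using orient_oriented[of "root p"] orient_compl[of "root p"] root_props(1) oriented_subset
  by (auto simp: base_def oriented_def)

lemma letter_cases:
  assumes "s \<in> letters" "src s \<noteq> {}"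
  shows "(\<exists>p\<in>oriented. root p \<noteq> p \<and> (s = Fwd p \<or> s = Bwd p)) \<or>
    (\<exists>q\<in>oriented. root q = q \<and> s = Flip q)"
  using assms by (auto simp: letters_def base_def)

text \<open>On complementary pairs the letters form stars: a pair that is not a root lies on one edge
only, so a walk that reaches it must turn back.\<close>

lemma walk_step:
  assumes s: "s \<in> letters" "src s \<noteq> {}" and t: "t \<in> letters" "src t \<noteq> {}"
    and walk: "orient (tgt s) = orient (src t)" and red: "t \<noteq> letter_inv s"
  shows "s \<noteq> Fwd p" "t \<noteq> Bwd p"
proof -
  show "s \<noteq> Fwd p"
  proof
    assume eq: "s = Fwd p"
    then have p: "p \<in> oriented" "root p \<noteq> p" using letter_cases[OF s] by auto
    then have "orient (src t) = p" using walk eq orient_oriented by simp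
    with letter_cases[OF t] p show False
      using red eq orient_oriented orient_base root_root by auto
  qed
  show "t \<noteq> Bwd p"
  proof
    assume eq: "t = Bwd p"
    then have p: "p \<in> oriented" "root p \<noteq> p" using letter_cases[OF t] by auto
    then have *: "orient (tgt s) = p" using walk eq orient_oriented by simp
    have "orient (N - q) = q" if "q \<in> oriented" for q
      using orient_compl orient_oriented oriented_subset that by simp
    with letter_cases[OF s] p * show False
      using red eq orient_oriented orient_base root_root by auto
  qed
qed

text \<open>The two inner letters can neither lead to a leaf nor come from one, hence both are the loop
at the root, and a loop is its own inverse.\<close>

lemma no_reduced_walk:
  assumes s: "s1 \<in> letters" "s2 \<in> letters" "s3 \<in> letters" "s4 \<in> letters"
    and ne: "src s1 \<noteq> {}" "src s2 \<noteq> {}" "src s3 \<noteq> {}" "src s4 \<noteq> {}"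
    and walk: "orient (tgt s1) = orient (src s2)" "orient (tgt s2) = orient (src s3)"
      "orient (tgt s3) = orient (src s4)"
    and red: "s2 \<noteq> letter_inv s1" "s3 \<noteq> letter_inv s2" "s4 \<noteq> letter_inv s3"
  shows False
proof -
  note 12 = walk_step[OF s(1) ne(1) s(2) ne(2) walk(1) red(1)]
  note 23 = walk_step[OF s(2) ne(2) s(3) ne(3) walk(2) red(2)]
  note 34 = walk_step[OF s(3) ne(3) s(4) ne(4) walk(3) red(3)]
  obtain q where q: "q \<in> oriented" "s2 = Flip q"
    using letter_cases[OF s(2) ne(2)] 12(2) 23(1) by blast
  obtain q' where q': "q' \<in> oriented" "s3 = Flip q'"
    using letter_cases[OF s(3) ne(3)] 23(2) 34(1) by blast
  show False
    using walk(2) red(2) q q' orient_compl orient_oriented oriented_subset by simp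
qed

text \<open>As long as a path remembers, its sets of possible colours increase in the deducibility
order. Among the sets after \<open>0\<close>, \<open>4\<close>, \<open>8\<close>, \<dots>
steps two are equal by the pigeonhole principle, and then consistency turns all inclusions
in between into equalities. This yields a reduced walk with four edges.\<close>

lemma long_reach:
  assumes w: "w \<in> lists letters" "reduced letter_inv w" and a: "a \<in> N"
    and len: "4 * 2 ^ card N \<le> length w"
  shows "reach w a = N"
proof (rule ccontr)
  assume ne: "reach w a \<noteq> N"
  define n where "n = length w"
  define suf where "suf i = drop (n - i) w" for i
  define S where "S i = reach (suf i) a" for i
  define s where "s i = w ! (n - Suc i)" for i
  have suf: "suf (Suc i) = s i # suf i" if "i < n" for i
    using that Cons_nth_drop_Suc[of "n - Suc i" w] by (simp add: suf_def s_def n_def Suc_diff_Suc)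
  have suf_lists: "suf i \<in> lists letters" for i
    using w(1) set_drop_subset[of "n - i" w] unfolding suf_def in_lists_conv_set by blast
  have S_ne: "S i \<noteq> N" if "i \<le> n" for i
    using that
  proof (induction rule: inc_induct)
    case base
    then show ?case using ne by (simp add: S_def suf_def)
  next
    case (step i)
    then show ?case
      using reach_step_proper(2)[of "s i" "suf i" a] suf[of i] suf_lists[of "Suc i"] a
      by (simp add: S_def)
  qed
  have edge: "src (s i) \<noteq> {}" "s i \<in> letters" "le (S i) (S (Suc i))"
    "S i \<subseteq> src (s i) \<and> S (Suc i) = tgt (s i) \<or> S i \<subseteq> N - src (s i) \<and> S (Suc i) = N - tgt (s i)"
    if "i < n" for i
    using reach_step_proper(1,3)[of "s i" "suf i" a] reach_step[of "s i" "suf i" a]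
      suf[OF that] suf_lists[of "Suc i"] a S_ne[of "Suc i"] that
    by (simp_all add: S_def)
  have le_S: "le (S i) (S j)" if "i \<le> j" "j \<le> n" for i j
    using that
  proof (induction j rule: dec_induct)
    case base
    then show ?case by (simp add: S_def le_subset reach_subset)
  next
    case (step k)
    then show ?case using edge(3)[of k] le_trans by simp
  qed
  have "(\<lambda>j. S (4 * j)) ` {..2 ^ card N} \<subseteq> Pow N"
    using reach_subset by (auto simp: S_def)
  then have "card ((\<lambda>j. S (4 * j)) ` {..(2::nat) ^ card N}) \<le> 2 ^ card N"
    using card_mono[of "Pow N"] finite_N by (simp add: card_Pow)
  then have "\<not> inj_on (\<lambda>j. S (4 * j)) {..(2::nat) ^ card N}"
    using card_image by fastforce
  then obtain i j where ij: "i < j" "j \<le> 2 ^ card N" "S (4 * i) = S (4 * j)"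
    unfolding inj_on_def by (metis atMost_iff linorder_neqE_nat)
  have jn: "4 * j \<le> n" "4 * i + 4 \<le> 4 * j" using ij len by (auto simp: n_def)
  have equal: "orient (S k) = orient (src (s k)) \<and> orient (S (Suc k)) = orient (tgt (s k))"
    if k: "4 * i \<le> k" "k < 4 * i + 4" for k
  proof -
    have kn: "k < n" "Suc k \<le> 4 * j" using k jn by auto
    have le: "le (S (Suc k)) (S k)"
      using le_S[of "Suc k" "4 * j"] le_S[of "4 * i" k] ij(3) kn k jn le_trans by (metis less_imp_le)
    have st: "eqv (src (s k)) (tgt (s k))" using src_tgt_eqv edge(2) kn by blast
    then have sub: "src (s k) \<subseteq> N" "tgt (s k) \<subseteq> N" by (auto simp: eqv_def)
    consider "S k \<subseteq> src (s k)" "S (Suc k) = tgt (s k)"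
      | "S k \<subseteq> N - src (s k)" "S (Suc k) = N - tgt (s k)"
      using edge(4)[OF kn(1)] by blast
    then show ?thesis
    proof cases
      case 1
      then have "src (s k) = S k"
        using st le le_trans sub le_consistent unfolding eqv_def by metis
      then show ?thesis using 1 by simp
    next
      case 2
      then have "N - src (s k) = S k"
        using eqv_compl[OF st] le le_trans le_consistent unfolding eqv_def by metis
      then show ?thesis using 2 orient_compl sub by metis
    qed
  qed
  have red: "s (Suc k) \<noteq> letter_inv (s k)" if "Suc k < n" for k
  proof -
    have "reduced letter_inv (suf (Suc (Suc k)))"
      using w(2) append_take_drop_id[of "n - Suc (Suc k)" w]
      unfolding reduced_def suf_def by (metis successively_append_iff)
    then show ?thesis using suf[of "Suc k"] suf[of k] that by (simp add: reduced_def)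
  qed
  define k where "k = 4 * i"
  have kn: "k < n" "Suc k < n" "Suc (Suc k) < n" "Suc (Suc (Suc k)) < n" using jn by (auto simp: k_def)
  show False
    by (rule no_reduced_walk[of "s k" "s (Suc k)" "s (Suc (Suc k))" "s (Suc (Suc (Suc k)))"])
      (use edge(1,2) kn red equal[of k] equal[of "Suc k"] equal[of "Suc (Suc k)"]
         equal[of "Suc (Suc (Suc k))"] in \<open>auto simp: k_def\<close>)
qed

lemma long_words_linked:
  assumes "w \<in> lists letters" "reduced letter_inv w" "4 * 2 ^ card N \<le> length w" "a \<in> N" "c \<in> N"
  shows "linked N valid w a c"
  using long_reach[OF assms(1,2,4,3)] assms(5) by (auto simp: reach_def)

lemma exists_long_word: "\<exists>w\<in>lists letters. reduced letter_inv w \<and> length w = n"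
proof (intro bexI conjI)
  have "Fwd {} \<in> letters" by (simp add: letters_def)
  then show "replicate n (Fwd {}) \<in> lists letters" by (auto simp: in_lists_conv_set)
  show "reduced letter_inv (replicate n (Fwd {}))"
    unfolding reduced_def by (induction n) (auto simp: successively_Cons)
qed simp

text \<open>Every set is linked to the root of its class by one letter, up to complements. Two sets of a
class are linked to the same side of the root or to opposite sides; in the latter case
either the complements match or the root is equivalent to its complement, and then
\<open>Flip\<close> joins the two sides.\<close>

lemma letters_generate:
  assumes Q_refl: "\<And>L. L \<subseteq> N \<Longrightarrow> Q L L"
    and Q_sym: "\<And>L R. Q L R \<Longrightarrow> Q R L"
    and Q_trans: "\<And>K L M. K \<subseteq> N \<Longrightarrow> L \<subseteq> N \<Longrightarrow> M \<subseteq> N \<Longrightarrow> Q K L \<Longrightarrow> Q L M \<Longrightarrow> Q K M"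
    and Q_compl: "\<And>L R. L \<subseteq> N \<Longrightarrow> R \<subseteq> N \<Longrightarrow> Q L R \<Longrightarrow> Q (N - L) (N - R)"
    and Q_letter: "\<And>s. s \<in> letters \<Longrightarrow> Q (src s) (tgt s)"
    and LR: "eqv L R" "L \<noteq> {}" "L \<noteq> N" "R \<noteq> {}" "R \<noteq> N"
  shows "Q L R"
proof -
  have sub: "base p \<subseteq> N" "p \<subseteq> N" if "p \<in> oriented" for p
    using base_eqv[OF that] by (simp_all add: eqv_def)
  have base: "Q (base p) p" if p: "p \<in> oriented" for p
  proof (cases "root p = p")
    case True
    then have "base p = p"
      using eqv_refl[of p] sub(2)[OF p] by (simp add: base_def)
    then show ?thesis using Q_refl sub(2)[OF p] by simp
  next
    case False
    then have "Fwd p \<in> letters" using p by (simp add: letters_def)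
    from Q_letter[OF this] show ?thesis by simp
  qed
  have nonempty: "p \<noteq> {}" if "p \<in> oriented" for p using that by (auto simp: oriented_def)
  have left_oriented: "Q L R"
    if L: "L \<in> oriented" and LR: "eqv L R" and R: "R \<noteq> {}" "R \<noteq> N" for L R
  proof -
    define q where "q = root L"
    have RN: "R \<subseteq> N" using LR by (simp add: eqv_def)
    have qN: "q \<subseteq> N" using root_props(1)[OF L] oriented_subset by (simp add: q_def)
    show ?thesis
    proof (cases "c0 \<in> R")
      case True
      then have Ro: "R \<in> oriented" using R RN by (auto simp: oriented_def)
      have "root L = root R" using root_cong[of L R] LR RN by simp
      then have "base L = base R"
        using eqv_cong[OF LR] nonempty L Ro by (simp add: base_def)
      then show ?thesis
        using base[OF L] base[OF Ro] Q_sym Q_trans sub[OF L] sub[OF Ro] by metis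
    next
      case False
      define p where "p = N - R"
      have R_p: "R = N - p" using RN by (simp add: p_def double_diff)
      have po: "p \<in> oriented" using False R RN c0_N by (auto simp: p_def oriented_def)
      have rp: "root p = q"
        using root_cong[of L p] LR R_p sub(2)[OF po] by (simp add: q_def)
      have bL: "base L = (if eqv q L then q else N - q)" "base p = (if eqv q p then q else N - q)"
        using nonempty L po rp by (simp_all add: base_def q_def)
      have "Q (base L) (N - base p)"
      proof (cases "eqv q L \<and> eqv q p")
        case True
        then have "eqv q R" using eqv_cong[OF LR] by simp
        moreover have "eqv R (N - q)"
          using eqv_compl[of p q] True eqv_sym R_p by simp
        ultimately have "eqv q (N - q)" using eqv_trans by blast
        moreover have "q \<in> oriented" "root q = q"
          using root_props(1)[OF L] root_root[OF L] by (simp_all add: q_def)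
        ultimately have "Flip q \<in> letters" by (simp add: letters_def)
        from Q_letter[OF this] show ?thesis using True bL by simp
      next
        case False
        have "eqv q L \<or> eqv q p"
        proof -
          have "eqv q L \<or> eqv q (N - L)" using root_props(2)[OF L] by (simp add: q_def)
          moreover have "eqv (N - L) p"
            using eqv_compl[OF LR] by (simp add: p_def)
          ultimately show ?thesis using eqv_trans by blast
        qed
        then have "base L = N - base p" using False bL qN by (auto simp: double_diff)
        then show ?thesis using Q_refl by simp
      qed
      moreover have "Q (N - base p) R"
        unfolding R_p by (rule Q_compl[OF sub[OF po] base[OF po]])
      ultimately have "Q (base L) R" using Q_trans sub[OF L] RN by (metis Diff_subset)
      then show ?thesis using base[OF L] Q_sym Q_trans sub[OF L] RN by metis
    qed
  qed
  have LN: "L \<subseteq> N" "R \<subseteq> N" using LR(1) by (simp_all add: eqv_def)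
  show ?thesis
  proof (cases "c0 \<in> L")
    case True
    then show ?thesis using left_oriented LR LN by (auto simp: oriented_def)
  next
    case False
    then have "N - L \<in> oriented" using LN LR c0_N by (auto simp: oriented_def)
    then have "Q (N - L) (N - R)"
      using left_oriented[OF _ eqv_compl[OF LR(1)]] LN LR by blast
    from Q_compl[OF _ _ this] show ?thesis using LN by (simp add: double_diff)
  qed
qed

end

section \<open>Meager sets\<close>

lemma meager_in_subset:
  assumes "meager_in T S" "S' \<subseteq> S"
  shows "meager_in T S'"
proof -
  obtain \<U> where U: "countable \<U>" "\<And>V. V \<in> \<U> \<Longrightarrow> nowhere_dense_in T V" "\<Union>\<U> = S"
    using assms(1) by (auto simp: meager_in_def union_of_def)
  have "nowhere_dense_in T (V \<inter> S')" if "V \<in> \<U>" for V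
    using U(2)[OF that] closure_of_mono[of "V \<inter> S'" V T]
      interior_of_mono[of "T closure_of (V \<inter> S')" "T closure_of V" T]
    unfolding nowhere_dense_in_def by blast
  moreover have "\<Union>((\<lambda>V. V \<inter> S') ` \<U>) = S'" using U(3) assms(2) by blast
  ultimately show ?thesis
    unfolding meager_in_def union_of_def using U(1)
    by (intro exI[of _ "(\<lambda>V. V \<inter> S') ` \<U>"]) auto
qed

lemma nowhere_dense_imp_meager: "nowhere_dense_in T S \<Longrightarrow> meager_in T S"
  unfolding meager_in_def union_of_def by (intro exI[of _ "{S}"]) auto

lemma meager_in_UN:
  assumes I: "countable I" and S: "\<And>i. i \<in> I \<Longrightarrow> meager_in T (S i)"
  shows "meager_in T (\<Union>i\<in>I. S i)"
proof -
  have "\<forall>i\<in>I. \<exists>\<U>. countable \<U> \<and> \<U> \<subseteq> Collect (nowhere_dense_in T) \<and> \<Union>\<U> = S i"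
    using S by (simp add: meager_in_def union_of_def)
  then obtain \<U> where U: "\<forall>i\<in>I. countable (\<U> i) \<and> \<U> i \<subseteq> Collect (nowhere_dense_in T) \<and> \<Union>(\<U> i) = S i"
    by metis
  have "\<Union>(\<Union>i\<in>I. \<U> i) = (\<Union>i\<in>I. \<Union>(\<U> i))" by blast
  also have "\<dots> = (\<Union>i\<in>I. S i)" using U by simp
  finally show ?thesis
    unfolding meager_in_def union_of_def using I U
    by (intro exI[of _ "\<Union>i\<in>I. \<U> i"]) auto
qed

lemma meager_in_Un: "meager_in T S \<Longrightarrow> meager_in T S' \<Longrightarrow> meager_in T (S \<union> S')"
  using meager_in_UN[of "UNIV :: bool set" T "\<lambda>b. if b then S else S'"] by (simp add: UNIV_bool Un_commute)

lemma nowhere_dense_in_complement: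
  assumes U: "openin T U" and dense: "\<And>W. openin T W \<Longrightarrow> W \<noteq> {} \<Longrightarrow> W \<inter> U \<noteq> {}"
  shows "nowhere_dense_in T (topspace T - U)"
proof -
  have "T closure_of (topspace T - U) = topspace T - U"
    using U by (simp add: closure_of_closedin closedin_diff)
  moreover have "T interior_of (topspace T - U) = {}"
    using dense[of "T interior_of (topspace T - U)"] interior_of_subset[of T "topspace T - U"] by auto
  ultimately show ?thesis by (simp add: nowhere_dense_in_def)
qed

section \<open>The free points of the sphere\<close>

text \<open>A vector fixed on the sphere near \<open>x\<close> gives fixed vectors \<open>x + t
v\<close> for all small \<open>t\<close> after rescaling.\<close>

lemma linear_fixes_open_subset_of_sphere:
  fixes g :: "'a::euclidean_space \<Rightarrow> 'a"
  assumes g: "linear g" and W: "openin (top_of_set (sphere 0 1)) W" "W \<noteq> {}"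
    and fixed: "\<And>x. x \<in> W \<Longrightarrow> g x = x"
  shows "g v = v"
proof -
  obtain x where x: "x \<in> W" using W by blast
  obtain O' where O': "open O'" "W = sphere 0 1 \<inter> O'" using W(1) openin_open by blast
  have nx: "norm x = 1" using x O' by auto
  define h where "h t = (1 / norm (x + t *\<^sub>R v)) *\<^sub>R (x + t *\<^sub>R v)" for t :: real
  have "isCont h 0"
    unfolding h_def using nx by (intro continuous_intros) auto
  then have "\<forall>\<^sub>F t in at 0. h t \<in> O'"
    using O'(1) x O' nx by (intro topological_tendstoD[of h "h 0"]) (auto simp: isCont_def h_def)
  moreover have "\<forall>\<^sub>F t in at 0. x + t *\<^sub>R v \<noteq> 0"
  proof -
    have "((\<lambda>t. x + t *\<^sub>R v) \<longlongrightarrow> x + 0 *\<^sub>R v) (at 0)" by (intro tendsto_intros)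
    then show ?thesis using nx by (intro tendsto_imp_eventually_ne) auto
  qed
  ultimately have "\<forall>\<^sub>F t in at 0. t \<noteq> 0 \<and> h t \<in> O' \<and> x + t *\<^sub>R v \<noteq> 0"
    by (intro eventually_conj) (auto simp: eventually_at_filter)
  then obtain t :: real where t: "t \<noteq> 0" "h t \<in> O'" "x + t *\<^sub>R v \<noteq> 0"
    using eventually_happens by force
  then have "h t \<in> W" using O'(2) by (simp add: h_def)
  then have "g (h t) = h t" by (rule fixed)
  then have "g (x + t *\<^sub>R v) = x + t *\<^sub>R v"
    using t(3) by (simp add: h_def linear_cmul[OF g])
  then have "t *\<^sub>R g v = t *\<^sub>R v"
    using fixed[OF x] by (simp add: linear_add[OF g] linear_cmul[OF g])
  then show ?thesis using t(1) by simp
qed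

abbreviation reflections :: "(nat \<Rightarrow> real ^ 3) \<Rightarrow> nat list \<Rightarrow> real ^ 3 \<Rightarrow> real ^ 3" where
  "reflections u \<equiv> foldr (\<lambda>i. reflection (u i))"

lemma linear_reflections: "linear (reflections u w)"
proof (induction w)
  case Nil
  then show ?case by (simp add: linear_id[unfolded id_def] id_def)
next
  case (Cons i w)
  then show ?case using linear_compose[OF Cons linear_reflection[of "u i"]] by (simp add: comp_def)
qed

lemma norm_reflections: "norm (reflections u w x) = norm x"
  by (induction w) (auto simp: norm_reflection)

lemma dist_reflections: "dist (reflections u w x) (reflections u w y) = dist x y"
  using norm_reflections[of u w "x - y"] by (simp add: dist_norm linear_diff[OF linear_reflections])

lemma reflections_rev: "reflections u (rev w) (reflections u w x) = x"
  by (induction w arbitrary: x) (auto simp: reflection_reflection)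

definition free_points :: "(nat \<Rightarrow> real ^ 3) \<Rightarrow> (real ^ 3) set" where
  "free_points u = {x \<in> S2. \<forall>w. (\<exists>z. reflections u w z \<noteq> z) \<longrightarrow> reflections u w x \<noteq> x}"

text \<open>A word fixing a translate of \<open>x\<close> is conjugate to a word fixing
\<open>x\<close>.\<close>

lemma reflections_free_points:
  assumes "x \<in> free_points u"
  shows "reflections u v x \<in> free_points u"
proof -
  have fixes_all: "reflections u w z = z"
    if "reflections u w (reflections u v x) = reflections u v x" for w z
  proof -
    have "reflections u (rev v @ w @ v) x = x" using that by (simp add: reflections_rev)
    then have *: "reflections u (rev v @ w @ v) y = y" for y
      using assms unfolding free_points_def by blast
    have vv: "reflections u v (reflections u (rev v) y) = y" for y
      using reflections_rev[of u "rev v" y] by simp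
    from *[of "reflections u (rev v) z"] have "reflections u (rev v) (reflections u w z) = reflections u (rev v) z"
      by (simp add: vv)
    then show ?thesis using vv by metis
  qed
  have "reflections u v x \<in> S2"
    using assms by (simp add: free_points_def norm_reflections)
  with fixes_all show ?thesis unfolding free_points_def by blast
qed

definition moved :: "(nat \<Rightarrow> real ^ 3) \<Rightarrow> nat list \<Rightarrow> (real ^ 3) set" where
  "moved u w = {x \<in> S2. reflections u w x \<noteq> x}"

lemma openin_moved: "openin (top_of_set S2) (moved u w)"
proof -
  have "continuous_on S2 (\<lambda>x. reflections u w x - x)"
    using linear_reflections by (intro continuous_intros linear_continuous_on) (simp add: linear_linear)
  then have "openin (top_of_set S2) (S2 \<inter> (\<lambda>x. reflections u w x - x) -` (- {0}))"
    by (rule continuous_openin_preimage_gen) auto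
  moreover have "S2 \<inter> (\<lambda>x. reflections u w x - x) -` (- {0}) = moved u w"
    by (auto simp: moved_def)
  ultimately show ?thesis by simp
qed

lemma moved_dense:
  assumes "reflections u w z \<noteq> z" "openin (top_of_set S2) W" "W \<noteq> {}"
  shows "W \<inter> moved u w \<noteq> {}"
proof
  assume "W \<inter> moved u w = {}"
  moreover have "W \<subseteq> S2" using assms(2) openin_imp_subset by blast
  ultimately have "\<And>x. x \<in> W \<Longrightarrow> reflections u w x = x" unfolding moved_def by blast
  from linear_fixes_open_subset_of_sphere[OF linear_reflections assms(2,3) this] assms(1)
  show False by blast
qed

lemma free_points_eq:
  "free_points u = S2 \<inter> (\<Inter>w\<in>{w. \<exists>z. reflections u w z \<noteq> z}. moved u w)"
  by (auto simp: free_points_def moved_def)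

lemma meager_nonfree_points: "meager_in (top_of_set S2) (S2 - free_points u)"
proof -
  have "S2 - free_points u = (\<Union>w\<in>{w. \<exists>z. reflections u w z \<noteq> z}. S2 - moved u w)"
    by (auto simp: free_points_eq)
  moreover have "meager_in (top_of_set S2) \<dots>"
  proof (intro meager_in_UN nowhere_dense_imp_meager)
    fix w assume "w \<in> {w. \<exists>z. reflections u w z \<noteq> z}"
    then obtain z where z: "reflections u w z \<noteq> z" by blast
    show "nowhere_dense_in (top_of_set S2) (S2 - moved u w)"
      using nowhere_dense_in_complement[OF openin_moved moved_dense[OF z]] by simp
  qed (rule countable_subset[OF subset_UNIV], simp)
  ultimately show ?thesis by simp
qed

lemma free_points_dense:
  assumes "openin (top_of_set S2) W" "W \<noteq> {}"
  shows "W \<inter> free_points u \<noteq> {}"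
proof -
  define \<G> where "\<G> = insert S2 (moved u ` {w. \<exists>z. reflections u w z \<noteq> z})"
  have "S2 \<subseteq> closure (\<Inter>\<G>)"
  proof (rule Baire)
    show "countable \<G>" unfolding \<G>_def by (intro countable_insert countable_image) simp
    fix T assume "T \<in> \<G>"
    then consider "T = S2" | w z where "T = moved u w" "reflections u w z \<noteq> z"
      by (auto simp: \<G>_def)
    then show "openin (top_of_set S2) T \<and> S2 \<subseteq> closure T"
    proof cases
      case 1
      then show ?thesis using closure_subset[of S2] by simp
    next
      case 2
      have "x \<in> closure (moved u w)" if "x \<in> S2" for x
        unfolding closure_iff_nhds_not_empty
      proof (intro allI impI)
        fix B V assume V: "V \<subseteq> B" "open V" "x \<in> V"
        then have "(S2 \<inter> V) \<inter> moved u w \<noteq> {}"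
          using that by (intro moved_dense[OF 2(2)]) (auto intro: openin_open_Int)
        then show "moved u w \<inter> B \<noteq> {}" using V by blast
      qed
      then show ?thesis using openin_moved 2(1) by blast
    qed
  qed simp
  moreover have "\<Inter>\<G> = free_points u" by (simp add: \<G>_def free_points_eq)
  ultimately have dense: "S2 \<subseteq> closure (free_points u)" by simp
  obtain T where T: "open T" "W = S2 \<inter> T" using assms(1) openin_open by blast
  obtain x where x: "x \<in> S2" "x \<in> T" using T assms by auto
  then have "free_points u \<inter> T \<noteq> {}"
    using dense T(1) by (metis closure_iff_nhds_not_empty subsetD subset_refl)
  then show ?thesis using T by (auto simp: free_points_def)
qed

section \<open>Quasi-solutions on the sphere\<close>

text \<open>Each of the sets in question is given three reflections of its own. The product of two of
them is used for an independent generator of infinite order, the third one for an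
involution.\<close>

fun spelling :: "('c set \<Rightarrow> nat) \<Rightarrow> 'c letter \<Rightarrow> nat list" where
  "spelling h (Fwd p) = [3 * h p, 3 * h p + 1]"
| "spelling h (Bwd p) = [3 * h p + 1, 3 * h p]"
| "spelling h (Flip p) = [3 * h p + 2]"

lemma spelling_letter_inv: "spelling h (letter_inv s) = rev (spelling h s)"
  by (cases s) auto

lemma spelling_nonempty: "spelling h s \<noteq> []"
  by (cases s) auto

fun letter_set :: "'c letter \<Rightarrow> 'c set" where
  "letter_set (Fwd p) = p" | "letter_set (Bwd p) = p" | "letter_set (Flip p) = p"

text \<open>Two successive letters cancel in the reflections only if they already cancel as letters.\<close>

lemma spelling_junction:
  assumes "s \<noteq> letter_inv t" "inj_on h P" "letter_set s \<in> P" "letter_set t \<in> P"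
  shows "last (spelling h s) \<noteq> hd (spelling h t)"
proof -
  have "h (letter_set s) = h (letter_set t) \<longleftrightarrow> letter_set s = letter_set t"
    using assms(2-4) by (auto dest: inj_onD)
  then show ?thesis using assms(1) by (cases s; cases t) (auto; presburger)+
qed

lemma distinct_adj_spelling:
  assumes h: "inj_on h P" and w: "\<And>s. s \<in> set w \<Longrightarrow> letter_set s \<in> P" and red: "reduced letter_inv w"
  shows "distinct_adj (concat (map (spelling h) w))"
  using w red
proof (induction w)
  case Nil
  then show ?case by simp
next
  case (Cons s w)
  have IH: "distinct_adj (concat (map (spelling h) w))"
    using Cons by (auto simp: reduced_def successively_Cons)
  have s: "distinct_adj (spelling h s)" by (cases s) auto
  show ?case
  proof (cases w)
    case Nil
    then show ?thesis using s by simp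
  next
    case (Cons t w')
    then have "last (spelling h s) \<noteq> hd (spelling h t)"
      using spelling_junction[OF _ h] Cons.prems by (auto simp: reduced_def)
    then show ?thesis
      using s IH Cons spelling_nonempty[of h t] by (simp add: distinct_adj_append_iff hd_append)
  qed
qed

context subcongruence_order
begin

lemma letter_set_subset: "s \<in> letters \<Longrightarrow> letter_set s \<in> Pow N"
  by (auto simp: letters_def dest!: oriented_subset)

lemma exists_free_letter_action:
  "\<exists>Y f. free_action S2 Y letters letter_inv f \<and> meager_in (top_of_set S2) (S2 - Y)"
proof -
  obtain h :: "'c set \<Rightarrow> nat" where h: "inj_on h (Pow N)"
    using finite_imp_inj_to_nat_seg[of "Pow N"] finite_N by auto
  \<comment> \<open>The sum is a convenient upper bound for all values of \<open>h\<close>.\<close>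
  define n where "n = 3 * sum h (Pow N) + 3"
  obtain u where u: "\<And>w. w \<noteq> [] \<Longrightarrow> set w \<subseteq> {..<n} \<Longrightarrow> distinct_adj w \<Longrightarrow> \<exists>x. reflections u w x \<noteq> x"
    using exists_free_reflections[of n] by metis
  define f where "f = (\<lambda>s. reflections u (spelling h s))"
  have f_word: "foldr f w = reflections u (concat (map (spelling h) w))" for w
    by (induction w) (auto simp: f_def)
  have spelling_bound: "set (spelling h s) \<subseteq> {..<n}" if "s \<in> letters" for s
  proof -
    have "h (letter_set s) \<le> sum h (Pow N)"
      using letter_set_subset[OF that] finite_N by (intro member_le_sum) auto
    then show ?thesis by (cases s) (auto simp: n_def)
  qed
  have "free_action S2 (free_points u) letters letter_inv f"
  proof
    show "finite letters" by (rule finite_letters)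
    show "letter_inv s \<in> letters" if "s \<in> letters" for s using that by (rule letter_inv_letters)
    show "letter_inv (letter_inv s) = s" for s :: "'c letter" by (rule letter_inv_inv)
    show "f s x \<in> S2" if "x \<in> S2" for s x using that by (simp add: f_def norm_reflections)
    show "f (letter_inv s) (f s x) = x" for s x by (simp add: f_def spelling_letter_inv reflections_rev)
    show "dist (f s x) (f s y) = dist x y" for s x y by (simp add: f_def dist_reflections)
    show "S2 \<noteq> {}" by simp
    show "free_points u \<subseteq> S2" by (auto simp: free_points_def)
    show "f s y \<in> free_points u" if "y \<in> free_points u" for s y
      using that by (simp add: f_def reflections_free_points)
    show "U \<inter> free_points u \<noteq> {}" if "openin (top_of_set S2) U" "U \<noteq> {}" for U
      using that by (rule free_points_dense)
    show "foldr f w y \<noteq> y"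
      if y: "y \<in> free_points u" and w: "w \<in> lists letters" "reduced letter_inv w" "w \<noteq> []" for y w
    proof -
      have "distinct_adj (concat (map (spelling h) w))"
        using distinct_adj_spelling[OF h _ w(2)] letter_set_subset w(1) by (auto simp: in_lists_conv_set)
      moreover have "set (concat (map (spelling h) w)) \<subseteq> {..<n}"
        using spelling_bound w(1) by (auto simp: in_lists_conv_set)
      moreover have "concat (map (spelling h) w) \<noteq> []"
        using w(3) spelling_nonempty by (cases w) auto
      ultimately show ?thesis using u y unfolding f_word free_points_def by blast
    qed
    show "\<exists>w\<in>lists letters. reduced letter_inv w \<and> length w = k" for k
      by (rule exists_long_word)
  qed
  then show ?thesis using meager_nonfree_points by blast
qed

text \<open>Let \<open>Z\<close> be the set of free points whose whole orbit is coloured. It is comeager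
and invariant, and on \<open>Z\<close> the colour classes form an exact partition satisfying
the congruences of all letters exactly. Being congruent on \<open>Z\<close> is an
equivalence relation that respects complements, so the congruences of the letters generate
all the others.\<close>

theorem exists_quasi_solution:
  "\<exists>A :: 'c \<Rightarrow> (real ^ 3) set.
    (\<forall>k\<in>N. openin (top_of_set S2) (A k) \<and> A k \<noteq> {}) \<and>
    (\<forall>j\<in>N. \<forall>k\<in>N. j \<noteq> k \<longrightarrow> meager_in (top_of_set S2) (A j \<inter> A k)) \<and>
    comeager_in (top_of_set S2) (\<Union>k\<in>N. A k) \<and>
    (\<forall>L R. eqv L R \<and> L \<noteq> {} \<and> L \<noteq> N \<and> R \<noteq> {} \<and> R \<noteq> N \<longrightarrow>
      (\<exists>\<sigma>. isometry_of S2 \<sigma> \<and>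
        meager_in (top_of_set S2) (sym_diff (\<sigma> ` (\<Union>k\<in>L. A k)) (\<Union>k\<in>R. A k))))"
proof -
  let ?S = "top_of_set S2"
  obtain Y f where fa: "free_action S2 Y letters letter_inv f" and Y: "meager_in ?S (S2 - Y)"
    using exists_free_letter_action by blast
  interpret act: free_action S2 Y letters letter_inv f by (rule fa)
  interpret col: edge_colouring S2 Y letters letter_inv f N valid "4 * 2 ^ card N"
  proof
    show "2 \<le> 4 * (2::nat) ^ card N" using one_le_power[of "2::nat" "card N"] by simp
    show "linked N valid w a c"
      if "w \<in> act.reduced_words" "4 * 2 ^ card N \<le> length w" "a \<in> N" "c \<in> N" for w a c
      using that long_words_linked by (simp add: act.reduced_words_def)
  qed (use finite_N c0_N valid_letter_inv valid_total in auto)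
  obtain A where A: "\<forall>k\<in>N. openin ?S (A k) \<and> A k \<noteq> {}"
    and disj: "\<forall>y\<in>Y. \<forall>j\<in>N. \<forall>k\<in>N. y \<in> A j \<longrightarrow> y \<in> A k \<longrightarrow> j = k"
    and val: "\<forall>y\<in>Y. \<forall>s\<in>letters. \<forall>j\<in>N. \<forall>k\<in>N. y \<in> A j \<longrightarrow> f s y \<in> A k \<longrightarrow> valid s j k"
    and dense: "\<forall>U. openin ?S U \<longrightarrow> U \<noteq> {} \<longrightarrow> U \<inter> (\<Union>k\<in>N. A k) \<noteq> {}"
    using col.exists_dense_colouring by (elim exE conjE) (rule that)
  have A_open: "openin ?S (A k)" and A_ne: "A k \<noteq> {}" if "k \<in> N" for k using A that by auto
  note A_disj = disj[rule_format] and A_valid = val[rule_format] and A_dense = dense[rule_format]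
  define D where "D = (\<Union>k\<in>N. A k)"
  have D_open: "openin ?S D" unfolding D_def using A_open by blast
  have D_S2: "D \<subseteq> S2" using D_open openin_imp_subset by blast
  have AS: "A k \<subseteq> S2" if "k \<in> N" for k using A_open[OF that] openin_imp_subset by blast
  define Z where "Z = {y \<in> Y. \<forall>w\<in>lists letters. foldr f w y \<in> D}"
  have Z_sub: "y \<in> Y" "y \<in> S2" "y \<in> D" if "y \<in> Z" for y
  proof -
    show "y \<in> Y" "y \<in> S2" using that act.Y_X by (auto simp: Z_def)
    have "foldr f [] y \<in> D" using that unfolding Z_def by blast
    then show "y \<in> D" by simp
  qed
  have Z_act: "foldr f w y \<in> Z" if y: "y \<in> Z" and w: "w \<in> lists letters" for y w
  proof -
    have all_D: "\<forall>v\<in>lists letters. foldr f v y \<in> D" using y by (simp add: Z_def)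
    have "foldr f v (foldr f w y) \<in> D" if "v \<in> lists letters" for v
    proof -
      have "v @ w \<in> lists letters" using that w by simp
      then have "foldr f (v @ w) y \<in> D" by (rule bspec[OF all_D])
      then show ?thesis by simp
    qed
    then show ?thesis using act.act_Y[OF w Z_sub(1)[OF y]] by (simp add: Z_def)
  qed
  have meager_Z: "meager_in ?S (S2 - Z)"
  proof (rule meager_in_subset)
    show "S2 - Z \<subseteq> (S2 - Y) \<union> (\<Union>w\<in>lists letters. S2 - foldr f (rev (map letter_inv w)) ` D)"
    proof
      fix x assume x: "x \<in> S2 - Z"
      show "x \<in> (S2 - Y) \<union> (\<Union>w\<in>lists letters. S2 - foldr f (rev (map letter_inv w)) ` D)"
      proof (cases "x \<in> Y")
        case True
        then obtain w where w: "w \<in> lists letters" "foldr f w x \<notin> D" using x by (auto simp: Z_def)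
        have "x \<notin> foldr f (rev (map letter_inv w)) ` D"
          using w act.act_winv'[OF w(1)] D_S2 by auto
        then show ?thesis using x w by blast
      qed (use x in blast)
    qed
    have "meager_in ?S (S2 - foldr f (rev (map letter_inv w)) ` D)" if w: "w \<in> lists letters" for w
    proof -
      have "W \<inter> foldr f (rev (map letter_inv w)) ` D \<noteq> {}" if W: "openin ?S W" "W \<noteq> {}" for W
      proof -
        have "foldr f w ` W \<inter> D \<noteq> {}"
          unfolding D_def using W act.openin_act_image[OF w] by (intro A_dense) auto
        moreover have "W \<subseteq> S2" using W(1) openin_imp_subset by blast
        ultimately show ?thesis using act.act_winv[OF w] by force
      qed
      from nowhere_dense_in_complement[OF act.openin_act_image[OF act.winv_lists[OF w] D_open] this]
      show ?thesis by (simp add: nowhere_dense_imp_meager)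
    qed
    moreover have "countable (lists letters)" using finite_letters by (simp add: countable_finite)
    ultimately show "meager_in ?S ((S2 - Y) \<union> (\<Union>w\<in>lists letters. S2 - foldr f (rev (map letter_inv w)) ` D))"
      using Y by (intro meager_in_Un meager_in_UN)
  qed
  have colour: "\<exists>k\<in>N. \<forall>L\<subseteq>N. y \<in> (\<Union>k\<in>L. A k) \<longleftrightarrow> k \<in> L" if y: "y \<in> Z" for y
  proof -
    obtain k where k: "k \<in> N" "y \<in> A k" using Z_sub(3)[OF y] by (auto simp: D_def)
    then have "y \<in> (\<Union>k\<in>L. A k) \<longleftrightarrow> k \<in> L" if "L \<subseteq> N" for L
      using A_disj[of y k] Z_sub(1)[OF y] that by blast
    then show ?thesis using k by blast
  qed
  define Q where "Q L R \<longleftrightarrow> (\<exists>w\<in>lists letters. \<forall>y\<in>Z. y \<in> (\<Union>k\<in>L. A k) \<longleftrightarrow> foldr f w y \<in> (\<Union>k\<in>R. A k))"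
    for L R
  have Q: "Q L R" if LR: "eqv L R" "L \<noteq> {}" "L \<noteq> N" "R \<noteq> {}" "R \<noteq> N" for L R
  proof (rule letters_generate[OF _ _ _ _ _ LR])
    show "Q L L" for L unfolding Q_def by (intro bexI[of _ "[]"]) auto
    show "Q R L" if "Q L R" for L R
    proof -
      obtain w where w: "w \<in> lists letters" "\<forall>y\<in>Z. y \<in> (\<Union>k\<in>L. A k) \<longleftrightarrow> foldr f w y \<in> (\<Union>k\<in>R. A k)"
        using \<open>Q L R\<close> unfolding Q_def by blast
      have "y \<in> (\<Union>k\<in>R. A k) \<longleftrightarrow> foldr f (rev (map letter_inv w)) y \<in> (\<Union>k\<in>L. A k)" if "y \<in> Z" for y
        using w Z_act[OF that act.winv_lists[OF w(1)]] act.act_winv'[OF w(1)] Z_sub(2)[OF that] by simp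
      then show ?thesis unfolding Q_def using act.winv_lists[OF w(1)] by blast
    qed
    show "Q K M" if "Q K L" "Q L M" for K L M
    proof -
      obtain v where v: "v \<in> lists letters"
        "\<forall>y\<in>Z. y \<in> (\<Union>k\<in>K. A k) \<longleftrightarrow> foldr f v y \<in> (\<Union>k\<in>L. A k)"
        using \<open>Q K L\<close> unfolding Q_def by (elim bexE) (rule that)
      obtain w where w: "w \<in> lists letters"
        "\<forall>y\<in>Z. y \<in> (\<Union>k\<in>L. A k) \<longleftrightarrow> foldr f w y \<in> (\<Union>k\<in>M. A k)"
        using \<open>Q L M\<close> unfolding Q_def by (elim bexE) (rule that)
      have "y \<in> (\<Union>k\<in>K. A k) \<longleftrightarrow> foldr f (w @ v) y \<in> (\<Union>k\<in>M. A k)" if "y \<in> Z" for y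
        using bspec[OF v(2) that] bspec[OF w(2) Z_act[OF that v(1)]] by simp
      moreover have "w @ v \<in> lists letters" using v(1) w(1) by simp
      ultimately show ?thesis unfolding Q_def by (intro bexI[of _ "w @ v"] ballI)
    qed
    show "Q (N - L) (N - R)" if LR: "L \<subseteq> N" "R \<subseteq> N" "Q L R" for L R
    proof -
      obtain w where w: "w \<in> lists letters" "\<forall>y\<in>Z. y \<in> (\<Union>k\<in>L. A k) \<longleftrightarrow> foldr f w y \<in> (\<Union>k\<in>R. A k)"
        using LR(3) unfolding Q_def by blast
      have compl: "y \<in> (\<Union>k\<in>N - K. A k) \<longleftrightarrow> y \<notin> (\<Union>k\<in>K. A k)" if "y \<in> Z" "K \<subseteq> N" for y K
        using colour[OF that(1)] that(2) by (metis Diff_iff Diff_subset)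
      have "y \<in> (\<Union>k\<in>N - L. A k) \<longleftrightarrow> foldr f w y \<in> (\<Union>k\<in>N - R. A k)" if "y \<in> Z" for y
        unfolding compl[OF that LR(1)] compl[OF Z_act[OF that w(1)] LR(2)]
        using bspec[OF w(2) that] by (simp only:)
      then show ?thesis unfolding Q_def using w(1) by blast
    qed
    show "Q (src s) (tgt s)" if s: "s \<in> letters" for s
    proof -
      have st: "src s \<subseteq> N" "tgt s \<subseteq> N" using src_tgt_eqv[OF s] by (auto simp: eqv_def)
      have sl: "[s] \<in> lists letters" using s by simp
      have "y \<in> (\<Union>k\<in>src s. A k) \<longleftrightarrow> foldr f [s] y \<in> (\<Union>k\<in>tgt s. A k)" if y: "y \<in> Z" for y
      proof -
        have y': "f s y \<in> Z" using Z_act[OF y sl] by simp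
        obtain j where j: "j \<in> N" "y \<in> A j" using Z_sub(3)[OF y] by (auto simp: D_def)
        obtain k where k: "k \<in> N" "f s y \<in> A k" using Z_sub(3)[OF y'] by (auto simp: D_def)
        have "y \<in> (\<Union>k\<in>src s. A k) \<longleftrightarrow> j \<in> src s"
          using A_disj[OF Z_sub(1)[OF y] j(1)] j st by blast
        moreover have "f s y \<in> (\<Union>k\<in>tgt s. A k) \<longleftrightarrow> k \<in> tgt s"
          using A_disj[OF Z_sub(1)[OF y'] k(1)] k st by blast
        moreover have "valid s j k" using A_valid Z_sub(1)[OF y] s j k by blast
        ultimately show ?thesis by (simp add: valid_def)
      qed
      then show ?thesis unfolding Q_def using sl by blast
    qed
  qed
  show ?thesis
  proof (intro exI[of _ A] conjI ballI allI impI)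
    show "openin ?S (A k)" if "k \<in> N" for k using A_open that .
    show "A k \<noteq> {}" if "k \<in> N" for k using A_ne that .
    show "meager_in ?S (A j \<inter> A k)" if "j \<in> N" "k \<in> N" "j \<noteq> k" for j k
    proof -
      have "A j \<inter> A k \<subseteq> S2 - Y" using A_disj that AS by blast
      then show ?thesis using meager_in_subset[OF Y] by blast
    qed
    show "comeager_in ?S (\<Union>k\<in>N. A k)"
      using D_S2 Z_sub(3) meager_in_subset[OF meager_Z, of "S2 - D"]
      by (auto simp: comeager_in_def D_def[symmetric])
    show "\<exists>\<sigma>. isometry_of S2 \<sigma> \<and> meager_in ?S (sym_diff (\<sigma> ` (\<Union>k\<in>L. A k)) (\<Union>k\<in>R. A k))"
      if "eqv L R \<and> L \<noteq> {} \<and> L \<noteq> N \<and> R \<noteq> {} \<and> R \<noteq> N" for L R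
    proof -
      have LR: "eqv L R" "L \<noteq> {}" "L \<noteq> N" "R \<noteq> {}" "R \<noteq> N" using that by auto
      obtain w where w: "w \<in> lists letters" "\<forall>y\<in>Z. y \<in> (\<Union>k\<in>L. A k) \<longleftrightarrow> foldr f w y \<in> (\<Union>k\<in>R. A k)"
        using Q[OF LR] unfolding Q_def by blast
      have sub: "(\<Union>k\<in>L. A k) \<subseteq> S2" "(\<Union>k\<in>R. A k) \<subseteq> S2" using AS LR(1) unfolding eqv_def by blast+
      have inv: "foldr f (rev (map letter_inv w)) x \<in> S2"
        "foldr f w (foldr f (rev (map letter_inv w)) x) = x" if "x \<in> S2" for x
        using act.act_X[OF act.winv_lists[OF w(1)] that] act.act_winv'[OF w(1) that] by auto
      have "isometry_of S2 (foldr f w)"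
        unfolding isometry_of_def
      proof (intro conjI ballI)
        show "foldr f w ` S2 = S2"
          using act.act_X[OF w(1)] inv by (metis (no_types, lifting) image_iff image_subsetI subsetI subset_antisym)
      qed (rule act.act_dist[OF w(1)])
      moreover have "sym_diff (foldr f w ` (\<Union>k\<in>L. A k)) (\<Union>k\<in>R. A k) \<subseteq> S2 - Z"
      proof
        fix x assume x: "x \<in> sym_diff (foldr f w ` (\<Union>k\<in>L. A k)) (\<Union>k\<in>R. A k)"
        have xS: "x \<in> S2" using x sub act.act_X[OF w(1)] by blast
        have "x \<notin> Z"
        proof
          assume xZ: "x \<in> Z"
          define y where "y = foldr f (rev (map letter_inv w)) x"
          have y: "y \<in> Z" "foldr f w y = x"
            using Z_act[OF xZ act.winv_lists[OF w(1)]] inv(2)[OF xS] by (simp_all add: y_def)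
          have "x \<in> foldr f w ` (\<Union>k\<in>L. A k) \<longleftrightarrow> y \<in> (\<Union>k\<in>L. A k)"
          proof
            assume "x \<in> foldr f w ` (\<Union>k\<in>L. A k)"
            then obtain z where z: "z \<in> (\<Union>k\<in>L. A k)" "x = foldr f w z" by blast
            then have "y = z" using act.act_winv[OF w(1)] sub by (auto simp: y_def)
            then show "y \<in> (\<Union>k\<in>L. A k)" using z by simp
          qed (use y in blast)
          moreover have "y \<in> (\<Union>k\<in>L. A k) \<longleftrightarrow> x \<in> (\<Union>k\<in>R. A k)" using w(2) y by simp
          ultimately show False using x by blast
        qed
        then show "x \<in> S2 - Z" using xS by blast
      qed
      ultimately show ?thesis using meager_in_subset[OF meager_Z] by blast
    qed
  qed
qed

end

lemma deducible_compl:
  assumes "\<And>c. c \<in> set C \<Longrightarrow> proper_congruence r c" and "deducible r C L R"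
  shows "deducible r C ({1..r} - R) ({1..r} - L)"
  using assms(2)
proof induction
  case (incl L R)
  then show ?case by (intro deducible.incl) auto
next
  case (fwd L R)
  then show ?case by (rule deducible.compl_bwd)
next
  case (bwd L R)
  then show ?case by (rule deducible.compl_fwd)
next
  case (compl_fwd L R)
  then have "L \<subseteq> {1..r}" "R \<subseteq> {1..r}" using assms(1) by (auto simp: proper_congruence_def)
  then show ?case using deducible.bwd[OF compl_fwd] by (simp only: double_diff subset_refl)
next
  case (compl_bwd L R)
  then have "L \<subseteq> {1..r}" "R \<subseteq> {1..r}" using assms(1) by (auto simp: proper_congruence_def)
  then show ?case using deducible.fwd[OF compl_bwd] by (simp only: double_diff subset_refl)
next
  case (trans K L M)
  show ?case using trans.IH(2,1) by (rule deducible.trans)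
qed

theorem theorem4p3:
  fixes r :: nat and C :: "congruence list"
  assumes "r \<ge> 1"
    and "\<And>c. c \<in> set C \<Longrightarrow> proper_congruence r c"
    and "consistent_system r C"
  shows "\<exists>(A :: nat \<Rightarrow> (real ^ 3) set) (\<sigma> :: nat \<Rightarrow> real ^ 3 \<Rightarrow> real ^ 3).
      (\<forall>k\<in>{1..r}. openin (top_of_set S2) (A k) \<and> A k \<noteq> {}) \<and>
      (\<forall>j\<in>{1..r}. \<forall>k\<in>{1..r}. j \<noteq> k \<longrightarrow> meager_in (top_of_set S2) (A j \<inter> A k)) \<and>
      comeager_in (top_of_set S2) (\<Union>k\<in>{1..r}. A k) \<and>
      (\<forall>i<length C. isometry_of S2 (\<sigma> i) \<and>
         meager_in (top_of_set S2)
           (sym_diff (\<sigma> i ` (\<Union>k\<in>fst (C ! i). A k)) (\<Union>k\<in>snd (C ! i). A k)))"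
proof -
  interpret subcongruence_order "{1..r}" "deducible r C" 1
  proof
    show "A = B" if "A \<subseteq> {1..r}" "deducible r C A B" "B \<subseteq> A" for A B
      using assms(3) that unfolding consistent_system_def by blast
    show "deducible r C ({1..r} - B) ({1..r} - A)" if "deducible r C A B" for A B
      using deducible_compl[OF assms(2) that] .
    show "1 \<in> {1..r}" using assms(1) by simp
  qed (simp, fact deducible.incl, fact deducible.trans)
  obtain A :: "nat \<Rightarrow> (real ^ 3) set" where A:
    "\<forall>k\<in>{1..r}. openin (top_of_set S2) (A k) \<and> A k \<noteq> {}"
    "\<forall>j\<in>{1..r}. \<forall>k\<in>{1..r}. j \<noteq> k \<longrightarrow> meager_in (top_of_set S2) (A j \<inter> A k)"
    "comeager_in (top_of_set S2) (\<Union>k\<in>{1..r}. A k)"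
    and realised: "\<forall>L R. eqv L R \<and> L \<noteq> {} \<and> L \<noteq> {1..r} \<and> R \<noteq> {} \<and> R \<noteq> {1..r} \<longrightarrow>
      (\<exists>\<sigma>. isometry_of S2 \<sigma> \<and>
        meager_in (top_of_set S2) (sym_diff (\<sigma> ` (\<Union>k\<in>L. A k)) (\<Union>k\<in>R. A k)))"
    using exists_quasi_solution by (elim exE conjE) (rule that)
  have "\<forall>i. \<exists>\<sigma>. i < length C \<longrightarrow> isometry_of S2 \<sigma> \<and> meager_in (top_of_set S2)
      (sym_diff (\<sigma> ` (\<Union>k\<in>fst (C ! i). A k)) (\<Union>k\<in>snd (C ! i). A k))"
  proof
    fix i
    show "\<exists>\<sigma>. i < length C \<longrightarrow> isometry_of S2 \<sigma> \<and> meager_in (top_of_set S2)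
      (sym_diff (\<sigma> ` (\<Union>k\<in>fst (C ! i). A k)) (\<Union>k\<in>snd (C ! i). A k))"
    proof (cases "i < length C")
      case True
      then have i: "(fst (C ! i), snd (C ! i)) \<in> set C" by simp
      have p: "fst (C ! i) \<noteq> {}" "fst (C ! i) \<subset> {1..r}" "snd (C ! i) \<noteq> {}" "snd (C ! i) \<subset> {1..r}"
        using assms(2)[OF i] by (auto simp: proper_congruence_def)
      then have "eqv (fst (C ! i)) (snd (C ! i))"
        unfolding eqv_def using deducible.fwd[OF i] deducible.bwd[OF i] by blast
      then show ?thesis using realised p by blast
    qed simp
  qed
  then obtain \<sigma> where "\<forall>i. i < length C \<longrightarrow> isometry_of S2 (\<sigma> i) \<and> meager_in (top_of_set S2)
      (sym_diff (\<sigma> i ` (\<Union>k\<in>fst (C ! i). A k)) (\<Union>k\<in>snd (C ! i). A k))"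
    by metis
  then show ?thesis using A by (intro exI[of _ A] exI[of _ \<sigma>] conjI)
qed

end
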